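(* Let $x_0\in\mathbb{R}^n$. The set of all $f\in\mathrm{Lip}_{x_0}(\mathbb{R}^n,\mathbb{R}^n)$ such that the generalized Jacobian $\partial f(x_0)$ is of maximal rank is open in the normed space $\left(\mathrm{Lip}_{x_0}(\mathbb{R}^n,\mathbb{R}^n),\,L(\cdot)\right)$.
   Context: $\|\cdot\|$ is the Euclidean norm on $\mathbb{R}^n$. For $f:\mathbb{R}^n\to\mathbb{R}^n$, $L(f)=\sup\left\{\frac{\|f(x)-f(y)\|}{\|x-y\|}:x\ne y\right\}$. $\mathrm{Lip}_{x_0}(\mathbb{R}^n,\mathbb{R}^n)$ is the vector space of all mappings $f:\mathbb{R}^n\to\mathbb{R}^n$ with $L(f)<\infty$ and $f(x_0)=0$; $L(\cdot)$ is a norm on it. For a Lipschitz mapping $f$ (differentiable almost everywhere by Rademacher's theorem), $Jf$ denotes the usual Jacobian matrix where it exists. The generalized Jacobian $\partial f(x_0)$ (Clarke) is the convex hull of all matrices of the form $\lim_{i\to\infty}Jf(x_i)$, where $x_i\to x_0$ and $f$ is differentiable at each $x_i$. $\partial f(x_0)$ is said to be of maximal rank if every matrix $M\in\partial f(x_0)$ has maximal rank (here: is invertible). *)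

theory Defs
  imports "HOL-Analysis.Analysis"
begin

text \<open>The dimension is \<open>CARD('n)\<close>, hence at least \<open>1\<close>; in particular the supremum below is
  taken over a nonempty set.\<close>

definition lip_const :: "(real^'n \<Rightarrow> real^'n) \<Rightarrow> ereal" where
  "lip_const f = (SUP (x, y) \<in> {(x, y). x \<noteq> y}. ereal (norm (f x - f y) / norm (x - y)))"

definition Lip :: "real^'n \<Rightarrow> (real^'n \<Rightarrow> real^'n) set" where
  "Lip x0 = {f. lip_const f < \<infinity> \<and> f x0 = 0}"

text \<open>The metric induced by the norm \<open>L\<close> on \<^term>\<open>Lip x0\<close>. The conversion to \<^typ>\<open>real\<close> is
  only meaningful where the Lipschitz constant of the difference is finite, which holds on
  \<^term>\<open>Lip x0\<close>.\<close>

definition lip_dist :: "(real^'n \<Rightarrow> real^'n) \<Rightarrow> (real^'n \<Rightarrow> real^'n) \<Rightarrow> real" where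
  "lip_dist f g = real_of_ereal (lip_const (\<lambda>x. f x - g x))"

abbreviation Lip_topology :: "real^'n \<Rightarrow> (real^'n \<Rightarrow> real^'n) topology" where
  "Lip_topology x0 \<equiv> Metric_space.mtopology (Lip x0) lip_dist"

definition generalized_jacobian :: "(real^'n \<Rightarrow> real^'n) \<Rightarrow> real^'n \<Rightarrow> (real^'n^'n) set" where
  "generalized_jacobian f x0 =
     convex hull {M. \<exists>X :: nat \<Rightarrow> real^'n. X \<longlonglongrightarrow> x0 \<and> (\<forall>i. f differentiable (at (X i))) \<and>
                       (\<lambda>i. jacobian f (at (X i))) \<longlonglongrightarrow> M}"

definition of_maximal_rank :: "(real^'n^'n) set \<Rightarrow> bool" where
  "of_maximal_rank S \<longleftrightarrow> (\<forall>M\<in>S. rank M = CARD('n))"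

lemma of_maximal_rank_iff_invertible:
  fixes S :: "(real^'n^'n) set"
  shows "of_maximal_rank S \<longleftrightarrow> (\<forall>M\<in>S. invertible M)"
  by (simp add: of_maximal_rank_def invertible_det_nz full_rank_injective flip: det_nz_iff_inj)

lemma lip_const_le_iff:
  "lip_const f \<le> ereal C \<longleftrightarrow> (\<forall>x y. norm (f x - f y) \<le> C * norm (x - y))"
proof -
  have "lip_const f \<le> ereal C \<longleftrightarrow> (\<forall>x y. x \<noteq> y \<longrightarrow> norm (f x - f y) \<le> C * norm (x - y))"
    by (auto simp: lip_const_def SUP_le_iff divide_le_eq)
  also have "\<dots> \<longleftrightarrow> (\<forall>x y. norm (f x - f y) \<le> C * norm (x - y))"
    by (metis cancel_comm_monoid_add_class.diff_cancel mult_zero_right norm_zero order_refl)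
  finally show ?thesis .
qed

lemma lip_const_nonneg: "0 \<le> lip_const (f :: real^'n \<Rightarrow> real^'n)"
proof -
  have "(0::real^'n) \<noteq> 1" by simp
  then show ?thesis
    unfolding lip_const_def
    by (intro SUP_upper2[where i = "(0, 1)"]) auto
qed

lemma lip_const_finite:
  assumes "lip_const f < \<infinity>"
  shows "lip_const f = ereal (real_of_ereal (lip_const f))"
  using assms lip_const_nonneg[of f] by (simp add: ereal_real abs_eq_infinity_cases)

lemma lip_const_bound:
  assumes "lip_const f < \<infinity>"
  shows "norm (f x - f y) \<le> real_of_ereal (lip_const f) * norm (x - y)"
  using lip_const_le_iff[of f "real_of_ereal (lip_const f)"] lip_const_finite[OF assms] by simp

lemma lip_const_add_le:
  assumes "lip_const f < \<infinity>" "lip_const g < \<infinity>"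
  shows "lip_const (\<lambda>x. f x + g x) \<le> lip_const f + lip_const g"
proof -
  have "norm ((f x + g x) - (f y + g y)) \<le>
      (real_of_ereal (lip_const f) + real_of_ereal (lip_const g)) * norm (x - y)" for x y
    using lip_const_bound[OF assms(1), of x y] lip_const_bound[OF assms(2), of x y]
      norm_triangle_ineq[of "f x - f y" "g x - g y"]
    by (simp add: algebra_simps)
  then have "lip_const (\<lambda>x. f x + g x) \<le>
      ereal (real_of_ereal (lip_const f) + real_of_ereal (lip_const g))"
    by (simp add: lip_const_le_iff)
  then show ?thesis
    using lip_const_finite[OF assms(1)] lip_const_finite[OF assms(2)]
    by (metis plus_ereal.simps(1))
qed

lemma lip_const_uminus: "lip_const (\<lambda>x. - f x) = lip_const f"
  by (simp add: lip_const_def norm_minus_commute)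

lemma lip_const_diff_finite:
  assumes "lip_const f < \<infinity>" "lip_const g < \<infinity>"
  shows "lip_const (\<lambda>x. f x - g x) < \<infinity>"
proof -
  have "lip_const (\<lambda>x. f x + - g x) \<le> lip_const f + lip_const g"
    using lip_const_add_le[of f "\<lambda>x. - g x"] assms by (simp add: lip_const_uminus)
  with assms show ?thesis
    by (auto simp: less_top[symmetric])
qed

lemma Metric_space_Lip:
  fixes x0 :: "real^'n"
  shows "Metric_space (Lip x0) lip_dist"
proof
  fix f g :: "real^'n \<Rightarrow> real^'n"
  show "0 \<le> lip_dist f g"
    by (simp add: lip_dist_def lip_const_nonneg real_of_ereal_pos)
  show "lip_dist f g = lip_dist g f"
    using lip_const_uminus[of "\<lambda>x. f x - g x"] by (simp add: lip_dist_def)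
next
  fix f g :: "real^'n \<Rightarrow> real^'n"
  assume fg: "f \<in> Lip x0" "g \<in> Lip x0"
  then have fin: "lip_const (\<lambda>x. f x - g x) < \<infinity>"
    by (auto simp: Lip_def intro: lip_const_diff_finite simp del: less_ereal.simps ereal_infty_less)
  show "lip_dist f g = 0 \<longleftrightarrow> f = g"
  proof
    assume "lip_dist f g = 0"
    then have "f x - g x = f x0 - g x0" for x
      using lip_const_bound[OF fin, of x x0] by (simp add: lip_dist_def)
    with fg show "f = g"
      by (auto simp: Lip_def fun_eq_iff)
  next
    assume "f = g"
    then have "lip_const (\<lambda>x. f x - g x) \<le> ereal 0"
      by (subst lip_const_le_iff) simp
    with \<open>f = g\<close> show "lip_dist f g = 0"
      using lip_const_nonneg[of "\<lambda>x. f x - g x"]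
      by (auto simp: lip_dist_def zero_ereal_def[symmetric] dest: antisym)
  qed
next
  fix f g h :: "real^'n \<Rightarrow> real^'n"
  assume "f \<in> Lip x0" "g \<in> Lip x0" "h \<in> Lip x0"
  then have fin: "lip_const (\<lambda>x. f x - g x) < \<infinity>" "lip_const (\<lambda>x. g x - h x) < \<infinity>"
      "lip_const (\<lambda>x. f x - h x) < \<infinity>"
    by (auto simp: Lip_def intro: lip_const_diff_finite simp del: less_ereal.simps ereal_infty_less)
  have "lip_const (\<lambda>x. f x - h x) \<le> lip_const (\<lambda>x. f x - g x) + lip_const (\<lambda>x. g x - h x)"
    using lip_const_add_le[OF fin(1,2)] by simp
  then have "ereal (lip_dist f h) \<le> ereal (lip_dist f g) + ereal (lip_dist g h)"
    using fin[THEN lip_const_finite] by (simp only: lip_dist_def)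
  then show "lip_dist f h \<le> lip_dist f g + lip_dist g h"
    by simp
qed

end

theory Submission
  imports Defs
begin

text \<open>
  If \<open>g\<close> is \<open>\<epsilon>\<close>-close to \<open>f\<close> in the Lipschitz norm, a point where \<open>g\<close> is differentiable need not
  be one for \<open>f\<close>, so the two generalized Jacobians are compared only weakly: for fixed \<open>u, v\<close> and
  \<open>M \<in> \<partial>g(x\<^sub>0)\<close> there is \<open>A \<in> \<partial>f(x\<^sub>0)\<close> with \<open>u \<bullet> A v \<ge> u \<bullet> M v - \<epsilon> \<bar>u\<bar> \<bar>v\<bar>\<close>. This rests on a mean value
  inequality whose intermediate point is a point of differentiability of \<open>f\<close>, available by
  Rademacher's theorem. Since \<open>\<partial>f(x\<^sub>0)\<close> is compact and consists of invertible matrices,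
  \<open>\<bar>A v\<bar> \<ge> \<delta> \<bar>v\<bar>\<close> on it for some \<open>\<delta> > 0\<close>. If \<open>M v = 0\<close> with \<open>v \<noteq> 0\<close> and \<open>\<epsilon> < \<delta>\<close>, then taking for \<open>- u\<close>
  the point of the compact convex set \<open>\<partial>f(x\<^sub>0) v\<close> closest to \<open>0\<close> gives a contradiction.

  For Rademacher's theorem, the set where the difference quotients of a Lipschitz function on the
  line oscillate across a gap \<open>p < q\<close> is null by the Vitali covering theorem. Fubini gives
  directional derivatives almost everywhere, and comparing integrals over boxes shows that they are
  additive in the direction.
\<close>

section \<open>Vitali covering and derivates on the line\<close>

text \<open>The short intervals on which \<open>g\<close> stretches by a factor at most
  \<open>p\<close> form a Vitali cover of \<open>E\<close>. A countable disjoint subfamily covers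
  \<open>E\<close> up to a null set, which the Lipschitz map \<open>g\<close> sends to a null set,
  and each chosen interval has an image of length at most \<open>p\<close> times its own.\<close>

lemma emeasure_image_le_derivate:
  fixes g :: "real \<Rightarrow> real"
  assumes g: "strict_mono g" and lip: "C-lipschitz_on UNIV g"
    and E: "E \<in> sets borel" and gE: "g ` E \<in> sets borel" and p: "0 \<le> p"
    and deriv: "\<And>x d. x \<in> E \<Longrightarrow> 0 < d \<Longrightarrow> \<exists>y. y \<noteq> x \<and> \<bar>y - x\<bar> < d \<and> \<bar>g y - g x\<bar> \<le> p * \<bar>y - x\<bar>"
  shows "emeasure lborel (g ` E) \<le> ennreal p * emeasure lborel E"
proof -
  have "emeasure lborel (g ` E) \<le> ennreal p * emeasure lborel E + ennreal e" if e: "0 < e" for e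
  proof -
    \<comment> \<open>Dividing by \<open>p + 1\<close> gives \<open>p * e' \<le> e\<close> and also
      covers \<open>p = 0\<close>.\<close>
    define e' where "e' = e / (p + 1)"
    have e': "0 < e'" using e p by (simp add: e'_def)
    obtain T where T: "open T" "E \<subseteq> T" "T - E \<in> lmeasurable" "emeasure lebesgue (T - E) < ennreal e'"
      using sets_lebesgue_outer_open[of E e'] E e' by auto
    define K where "K = {(x, y). x < y \<and> {x..y} \<subseteq> T \<and> \<bar>g y - g x\<bar> \<le> p * \<bar>y - x\<bar>}"
    \<comment> \<open>The covering theorem is stated for closed balls; on the line these are
      intervals, described by midpoint and half-length.\<close>
    have cb: "cball ((fst i + snd i) / 2) ((snd i - fst i) / 2) = {fst i .. snd i}" for i :: "real \<times> real"
      by (auto simp: cball_eq_atLeastAtMost field_simps)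
    have "\<exists>i. i \<in> K \<and> x \<in> cball ((fst i + snd i) / 2) ((snd i - fst i) / 2) \<and> (snd i - fst i) / 2 < d"
      if x: "x \<in> E" and d: "0 < d" for x d
    proof -
      obtain \<epsilon> where \<epsilon>: "0 < \<epsilon>" "ball x \<epsilon> \<subseteq> T" using T x by (meson openE subsetD)
      obtain y where y: "y \<noteq> x" "\<bar>y - x\<bar> < min d \<epsilon>" "\<bar>g y - g x\<bar> \<le> p * \<bar>y - x\<bar>"
        using deriv[OF x, of "min d \<epsilon>"] d \<epsilon> by auto
      have "{min x y..max x y} \<subseteq> ball x \<epsilon>" using y by (auto simp: dist_real_def)
      then have "(min x y, max x y) \<in> K" using y \<epsilon> unfolding K_def
        by (auto simp: min_def max_def abs_minus_commute)
      then show ?thesis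
        using y unfolding cb by (intro exI[of _ "(min x y, max x y)"]) auto
    qed
    then obtain S where S: "countable S" "S \<subseteq> K"
       "pairwise (\<lambda>i j. disjnt (cball ((fst i + snd i) / 2) ((snd i - fst i) / 2)) (cball ((fst j + snd j) / 2) ((snd j - fst j) / 2))) S"
       "negligible (E - (\<Union>i\<in>S. cball ((fst i + snd i) / 2) ((snd i - fst i) / 2)))"
      using Vitali_covering_theorem_cballs[of K "\<lambda>i. (snd i - fst i) / 2" E "\<lambda>i. (fst i + snd i) / 2"]
      unfolding K_def by force
    define I where "I i = {fst i .. snd i}" for i :: "real \<times> real"
    define J where "J i = {g (fst i) .. g (snd i)}" for i :: "real \<times> real"
    note S = S[unfolded cb I_def[symmetric]]
    have cont: "continuous_on A g" for A
      using lip lipschitz_on_continuous_on lipschitz_on_subset by blast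
    have gI: "g ` I i \<subseteq> J i" for i
      using g by (auto simp: I_def J_def strict_mono_less_eq)
    have Jg: "J i = g ` I i" if "i \<in> S" for i
    proof -
      have "fst i < snd i" using that S(2) by (auto simp: K_def)
      have "J i \<subseteq> g ` I i"
      proof
        fix z assume "z \<in> J i"
        then show "z \<in> g ` I i"
          using IVT'[of g "fst i" z "snd i"] cont \<open>fst i < snd i\<close> by (force simp: J_def I_def)
      qed
      with gI show ?thesis by blast
    qed
    have disI: "disjoint_family_on I S"
      using S(3) by (auto simp: disjoint_family_on_def pairwise_def disjnt_def)
    have disJ: "disjoint_family_on J S"
      using disI by (simp add: disjoint_family_on_def Jg strict_mono_imp_inj_on[OF g] flip: image_Int)
    \<comment> \<open>The image of the uncovered part is only shown to be Lebesgue null, so the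
      estimate passes through \<open>lebesgue\<close> until that part is discarded.\<close>
    have "negligible (g ` (E - (\<Union>i\<in>S. I i)))"
      by (rule negligible_locally_Lipschitz_image[OF _ S(4)])
        (use lip in \<open>auto intro!: exI[of _ UNIV] exI[of _ C] simp: lipschitz_on_def dist_norm\<close>)
    then have N: "g ` (E - (\<Union>i\<in>S. I i)) \<in> null_sets lebesgue"
      by (simp add: negligible_iff_null_sets)
    have mI: "I i \<in> sets lborel" "J i \<in> sets lborel" for i by (auto simp: I_def J_def)
    have UI: "(\<Union>i\<in>S. I i) \<in> sets lborel" "(\<Union>i\<in>S. J i) \<in> sets lborel"
      using S(1) mI by auto
    have "emeasure lborel (g ` E) = emeasure lebesgue (g ` E)" using gE by simp
    also have "\<dots> \<le> emeasure lebesgue ((\<Union>i\<in>S. J i) \<union> g ` (E - (\<Union>i\<in>S. I i)))"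
    proof (rule emeasure_mono)
      show "g ` E \<subseteq> (\<Union>i\<in>S. J i) \<union> g ` (E - (\<Union>i\<in>S. I i))"
        using gI by blast
      show "(\<Union>i\<in>S. J i) \<union> g ` (E - (\<Union>i\<in>S. I i)) \<in> sets lebesgue"
        using N UI by (intro sets.Un) auto
    qed
    also have "\<dots> = emeasure lebesgue (\<Union>i\<in>S. J i)"
      by (rule emeasure_Un_null_set) (use N UI in auto)
    also have "\<dots> = emeasure lborel (\<Union>i\<in>S. J i)" using UI by simp
    also have "\<dots> = (\<integral>\<^sup>+i. emeasure lborel (J i) \<partial>count_space S)"
      by (rule emeasure_UN_countable) (use S disJ mI in auto)
    also have "\<dots> \<le> (\<integral>\<^sup>+i. ennreal p * emeasure lborel (I i) \<partial>count_space S)"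
    proof (rule nn_integral_mono)
      fix i assume "i \<in> space (count_space S)"
      then have i: "fst i < snd i" "\<bar>g (snd i) - g (fst i)\<bar> \<le> p * \<bar>snd i - fst i\<bar>" using S(2) by (auto simp: K_def)
      then have "g (fst i) < g (snd i)" using g by (simp add: strict_mono_less)
      with i show "emeasure lborel (J i) \<le> ennreal p * emeasure lborel (I i)"
        using p by (simp add: I_def J_def ennreal_mult[symmetric])
    qed
    also have "\<dots> = ennreal p * (\<integral>\<^sup>+i. emeasure lborel (I i) \<partial>count_space S)"
      by (rule nn_integral_cmult) auto
    also have "\<dots> = ennreal p * emeasure lborel (\<Union>i\<in>S. I i)"
      by (subst emeasure_UN_countable) (use S disI mI in auto)
    also have "\<dots> \<le> ennreal p * emeasure lborel T"
    proof (intro mult_left_mono emeasure_mono)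
      have "I i \<subseteq> T" if "i \<in> S" for i
        using that S(2) by (cases i) (force simp: K_def I_def)
      then show "(\<Union>i\<in>S. I i) \<subseteq> T" by blast
    qed (use T in auto)
    also have "emeasure lborel T \<le> emeasure lborel E + ennreal e'"
    proof -
      have "emeasure lborel T = emeasure lborel E + emeasure lborel (T - E)"
        using T(1,2) E by (subst plus_emeasure) (auto simp: Un_absorb1)
      then show ?thesis using T E by (auto intro!: add_left_mono)
    qed
    then have "ennreal p * emeasure lborel T \<le> ennreal p * emeasure lborel E + ennreal p * ennreal e'"
      by (metis mult_left_mono distrib_left zero_le)
    also have "ennreal p * ennreal e' \<le> ennreal e"
      using p e by (auto simp: ennreal_mult[symmetric] e'_def field_simps)
    finally show ?thesis by (simp add: add_left_mono)
  qed
  then show ?thesis by (rule ennreal_le_epsilon) 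
qed

text \<open>Steps \<open>t\<close> of both signs are allowed. For Lipschitz \<open>f\<close>, the
  two-sided derivative along \<open>v\<close> fails to exist at \<open>x\<close> exactly when
  \<open>x\<close> lies in such a set for some rationals \<open>p < q\<close>, so countably many
  null sets have to be excluded.\<close>

definition derivate_gap :: "('a::real_normed_vector \<Rightarrow> real) \<Rightarrow> 'a \<Rightarrow> real \<Rightarrow> real \<Rightarrow> 'a set" where
  "derivate_gap f v p q =
     {x. (\<forall>d>0. \<exists>t. t \<noteq> 0 \<and> \<bar>t\<bar> < d \<and> (f (x + t *\<^sub>R v) - f x) / t < p) \<and>
         (\<forall>d>0. \<exists>t. t \<noteq> 0 \<and> \<bar>t\<bar> < d \<and> q < (f (x + t *\<^sub>R v) - f x) / t)}"

text \<open>For fixed \<open>t\<close> each inequality is an open condition on \<open>x\<close>, and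
  arbitrary unions over \<open>t\<close> stay open. Restricting \<open>d\<close> to the numbers
  \<open>inverse (real (Suc n))\<close> exhibits the set as a countable intersection of open
  sets.\<close>

lemma derivate_gap_borel:
  assumes "continuous_on UNIV f"
  shows "derivate_gap f v p q \<in> sets borel"
proof -
  have *: "{x. \<forall>d>0. \<exists>t. t \<noteq> 0 \<and> \<bar>t\<bar> < d \<and> P x t} =
      (\<Inter>n. \<Union>t\<in>{t. t \<noteq> 0 \<and> \<bar>t\<bar> < inverse (real (Suc n))}. {x. P x t})" for P :: "'a \<Rightarrow> real \<Rightarrow> bool"
  proof (intro equalityI subsetI; clarsimp)
    fix x and d :: real
    assume *: "\<forall>n. \<exists>t. t \<noteq> 0 \<and> \<bar>t\<bar> < inverse (1 + real n) \<and> P x t" and d: "0 < d"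
    then obtain n where "inverse (1 + real n) < d" using reals_Archimedean[OF d] by auto
    with * show "\<exists>t. t \<noteq> 0 \<and> \<bar>t\<bar> < d \<and> P x t" by (meson less_trans)
  qed
  have cont: "continuous_on UNIV (\<lambda>x. (f (x + t *\<^sub>R v) - f x) / t)" if "t \<noteq> 0" for t
    using that by (intro continuous_intros continuous_on_compose2[OF assms]) auto
  have "derivate_gap f v p q =
     (\<Inter>n. \<Union>t\<in>{t. t \<noteq> 0 \<and> \<bar>t\<bar> < inverse (real (Suc n))}. {x. (f (x + t *\<^sub>R v) - f x) / t < p}) \<inter>
     (\<Inter>n. \<Union>t\<in>{t. t \<noteq> 0 \<and> \<bar>t\<bar> < inverse (real (Suc n))}. {x. q < (f (x + t *\<^sub>R v) - f x) / t})"
    unfolding *[symmetric] by (auto simp: derivate_gap_def)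
  also have "\<dots> \<in> sets borel"
    by (intro sets.Int sets.countable_INT'' borel_open open_UN ballI open_Collect_less cont continuous_intros) auto
  finally show ?thesis .
qed

text \<open>Adding a large multiple of the identity makes \<open>f\<close> bi-Lipschitz, and the covering estimate is
  applied to the resulting homeomorphism and to its inverse: \<open>q' \<mu>(E) \<le> \<mu>(g E) \<le> p' \<mu>(E)\<close>.\<close>

lemma derivate_gap_null_real:
  fixes f :: "real \<Rightarrow> real"
  assumes lip: "L-lipschitz_on UNIV f" and pq: "p < q"
  shows "derivate_gap f 1 p q \<in> null_sets lborel"
proof -
  have L: "0 \<le> L" and fL: "\<bar>f x - f y\<bar> \<le> L * \<bar>x - y\<bar>" for x y
    using lip by (auto simp: lipschitz_on_def dist_real_def)
  \<comment> \<open>The factor \<open>L + 1\<close> keeps all slopes of \<open>g\<close> between 1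
    and \<open>2 * L + 1\<close>, so \<open>g\<close> is increasing and its inverse is
    1-Lipschitz.\<close>
  define g where "g x = (L + 1) * x + f x" for x
  have g_eq: "g y - g x = (L + 1) * (y - x) + (f y - f x)" for x y
    by (simp add: g_def algebra_simps)
  have g_up: "\<bar>g y - g x\<bar> \<le> (2 * L + 1) * \<bar>y - x\<bar>" for x y
  proof -
    have "\<bar>g y - g x\<bar> \<le> \<bar>(L + 1) * (y - x)\<bar> + \<bar>f y - f x\<bar>" unfolding g_eq by (rule abs_triangle_ineq)
    also have "\<bar>(L + 1) * (y - x)\<bar> = (L + 1) * \<bar>y - x\<bar>" using L by (simp add: abs_mult)
    finally show ?thesis using fL[of y x] by (simp add: algebra_simps)
  qed
  have g_low: "y - x \<le> g y - g x" if "x \<le> y" for x y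
    using fL[of y x] that unfolding g_eq by (simp add: algebra_simps abs_le_iff)
  have mono: "strict_mono g"
    using g_low by (intro strict_monoI) (smt (verit))
  have g_low': "\<bar>y - x\<bar> \<le> \<bar>g y - g x\<bar>" for x y
    using g_low[of x y] g_low[of y x] by (cases "x \<le> y") auto
  have contg: "continuous_on A g" for A
    unfolding g_def using lip lipschitz_on_continuous_on continuous_on_subset
    by (intro continuous_intros) blast
  have surj: "\<exists>x. g x = z" for z
  proof -
    \<comment> \<open>Since \<open>g\<close> grows at least as fast as the identity, moving by the
      distance from \<open>g 0\<close> to \<open>z\<close> is enough to reach
      \<open>z\<close>.\<close>
    have "g (- \<bar>z - g 0\<bar>) \<le> z" "z \<le> g \<bar>z - g 0\<bar>"
      using g_low[of "- \<bar>z - g 0\<bar>" 0] g_low[of 0 "\<bar>z - g 0\<bar>"] by auto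
    then show ?thesis using IVT'[of g "- \<bar>z - g 0\<bar>" z "\<bar>z - g 0\<bar>"] contg by force
  qed
  define h where "h = inv g"
  have gh: "g (h z) = z" and hg: "h (g x) = x" for x z
    using surj strict_mono_imp_inj_on[OF mono]
    by (auto simp: h_def intro!: f_inv_into_f) (metis rangeI)
  have monoh: "strict_mono h"
    by (metis gh mono strict_mono_less strict_mono_def)
  have lipg: "(2 * L + 1)-lipschitz_on UNIV g" and liph: "1-lipschitz_on UNIV h"
    using L g_up g_low'[of "h x" "h y" for x y] by (auto simp: lipschitz_on_def dist_real_def gh)
  have contg': "g \<in> borel_measurable borel" "h \<in> borel_measurable borel"
    using contg liph by (auto intro: borel_measurable_continuous_onI lipschitz_on_continuous_on)
  \<comment> \<open>Cutting to a bounded interval makes the measure finite, so that it can be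
    cancelled at the end.\<close>
  have "emeasure lborel (derivate_gap f 1 p q \<inter> {-real n..real n}) = 0" for n
  proof (rule ccontr)
    define E where "E = derivate_gap f 1 p q \<inter> {-real n..real n}"
    assume "emeasure lborel (derivate_gap f 1 p q \<inter> {-real n..real n}) \<noteq> 0"
    then have E0: "emeasure lborel E \<noteq> 0" by (simp add: E_def)
    have EB: "E \<in> sets borel"
      using lip by (auto simp: E_def intro!: derivate_gap_borel lipschitz_on_continuous_on)
    have gE: "g ` E = h -` E \<inter> space borel"
      using gh hg by (auto simp: image_iff) metis
    then have gEB: "g ` E \<in> sets borel"
      using measurable_sets[OF contg'(2) EB] by simp
    have hgE: "h ` g ` E = E" by (simp add: image_image hg)
    define p' q' where "p' = p + L + 1" and "q' = q + L + 1"
    \<comment> \<open>A point of \<open>E\<close> yields a quotient of \<open>f\<close> below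
      \<open>p\<close>. Quotients are at least \<open>- L\<close>, which forces \<open>p'\<close> to
      be positive.\<close>
    obtain x where "x \<in> E" using E0 by (metis emeasure_empty equals0I)
    then obtain t where "t \<noteq> 0" "(f (x + t) - f x) / t < p"
      unfolding E_def derivate_gap_def by (auto dest!: spec[of _ 1])
    have Q: "\<bar>(f (x + t) - f x) / t\<bar> \<le> L" if "t \<noteq> 0" for x t
      using fL[of "x + t" x] that by (simp add: abs_divide divide_le_eq)
    have p': "0 < p'" "p' < q'"
      using Q[OF \<open>t \<noteq> 0\<close>, of x] \<open>_ < p\<close> pq unfolding p'_def q'_def abs_le_iff by linarith+
    have quot: "g (x + t) - g x = t * ((f (x + t) - f x) / t + L + 1)" if "t \<noteq> 0" for x t
      using that by (simp add: g_eq field_simps)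
    have abs_quot: "\<bar>g (x + t) - g x\<bar> = \<bar>t\<bar> * ((f (x + t) - f x) / t + L + 1)" if "t \<noteq> 0" for x t
      using Q[OF that, of x] unfolding quot[OF that] abs_mult abs_le_iff by (subst abs_of_nonneg) (linarith, rule refl)
    have 1: "emeasure lborel (g ` E) \<le> ennreal p' * emeasure lborel E"
    proof (rule emeasure_image_le_derivate[OF mono lipg EB gEB])
      fix x d :: real assume "x \<in> E" "0 < d"
      then obtain t where t: "t \<noteq> 0" "\<bar>t\<bar> < d" "(f (x + t) - f x) / t < p"
        unfolding E_def derivate_gap_def by auto
      then have "\<bar>g (x + t) - g x\<bar> \<le> \<bar>t\<bar> * p'"
        unfolding abs_quot[OF t(1)] p'_def by (intro mult_left_mono) auto
      with t show "\<exists>y. y \<noteq> x \<and> \<bar>y - x\<bar> < d \<and> \<bar>g y - g x\<bar> \<le> p' * \<bar>y - x\<bar>"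
        by (intro exI[of _ "x + t"]) (auto simp: mult.commute)
    qed (use p' in auto)
    have 2: "emeasure lborel (h ` g ` E) \<le> ennreal (1 / q') * emeasure lborel (g ` E)"
    proof (rule emeasure_image_le_derivate[OF monoh liph gEB])
      fix z d :: real assume "z \<in> g ` E" "0 < d"
      then obtain x where x: "x \<in> E" "z = g x" by auto
      \<comment> \<open>A step this short moves the value of \<open>g\<close> by less than
        \<open>d\<close>.\<close>
      have "0 < d / (2 * L + 1)" using \<open>0 < d\<close> L by auto
      with x obtain t where t: "t \<noteq> 0" "\<bar>t\<bar> < d / (2 * L + 1)" "q < (f (x + t) - f x) / t"
        unfolding E_def derivate_gap_def by auto
      have "\<bar>t\<bar> * q' \<le> \<bar>g (x + t) - g x\<bar>"
        using t unfolding abs_quot[OF t(1)] q'_def by (intro mult_left_mono) auto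
      moreover have "\<bar>g (x + t) - g x\<bar> < d"
      proof -
        have "(2 * L + 1) * \<bar>t\<bar> < d" using t(2) L by (simp add: less_divide_eq mult.commute)
        with g_up[of "x + t" x] show ?thesis by simp
      qed
      moreover have "g (x + t) \<noteq> z" using t(1) x by (metis add_cancel_left_right hg)
      ultimately show "\<exists>y. y \<noteq> z \<and> \<bar>y - z\<bar> < d \<and> \<bar>h y - h z\<bar> \<le> 1 / q' * \<bar>y - z\<bar>"
        using p' by (intro exI[of _ "g (x + t)"]) (auto simp: x hg field_simps)
    qed (use p' EB hgE in auto)
    have fin: "emeasure lborel E < \<infinity>"
    proof -
      have "emeasure lborel E \<le> emeasure lborel {-real n..real n}"
        by (intro emeasure_mono) (auto simp: E_def)
      then show ?thesis by (simp add: le_less_trans)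
    qed
    define m where "m = measure lborel E"
    have m: "emeasure lborel E = ennreal m" "0 \<le> m" using fin
      by (auto simp: m_def emeasure_eq_ennreal_measure)
    \<comment> \<open>Chaining both estimates gives \<open>m \<le> (p' / q') * m\<close> with
      \<open>p' < q'\<close>, impossible for finite positive \<open>m\<close>.\<close>
    have "ennreal m \<le> ennreal (1 / q') * (ennreal p' * ennreal m)"
      using 2 mult_left_mono[OF 1, of "ennreal (1 / q')"] unfolding hgE m by (meson order_trans zero_le)
    also have "\<dots> = ennreal (1 / q' * (p' * m))"
      using p' m by (simp add: ennreal_mult[symmetric])
    finally have "m \<le> 1 / q' * (p' * m)" using p' m by (simp add: ennreal_le_iff)
    moreover have "0 < m" using E0 m by (cases "m = 0") auto
    ultimately show False using p' by (simp add: field_simps)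
  qed
  then have "(\<Union>n. derivate_gap f 1 p q \<inter> {-real n..real n}) \<in> null_sets lborel"
    using lip by (intro null_sets_UN null_setsI) (auto intro!: derivate_gap_borel lipschitz_on_continuous_on)
  also have "(\<Union>n. derivate_gap f 1 p q \<inter> {-real n..real n}) = derivate_gap f 1 p q"
  proof -
    have "\<exists>n. x \<in> {-real n..real n}" for x :: real
      using real_arch_simple[of "\<bar>x\<bar>"] by (auto simp: abs_le_iff minus_le_iff)
    then show ?thesis by blast
  qed
  finally show ?thesis .
qed

section \<open>Directional derivatives\<close>

lemma nn_integral_lborel_translate:
  fixes c :: "'a::euclidean_space"
  assumes [measurable]: "f \<in> borel_measurable borel"
  shows "(\<integral>\<^sup>+x. f (x + c) \<partial>lborel) = (\<integral>\<^sup>+x. f x \<partial>lborel)"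
proof -
  have "(\<integral>\<^sup>+x. f x \<partial>lborel) = (\<integral>\<^sup>+x. f x \<partial>distr lborel borel ((+) c))"
    by (simp add: lborel_distr_plus)
  also have "\<dots> = (\<integral>\<^sup>+x. f (x + c) \<partial>lborel)"
    by (subst nn_integral_distr) (auto simp: add.commute)
  finally show ?thesis by simp
qed

text \<open>Translation invariance gives every translate of \<open>N\<close> along \<open>v\<close>
  the same measure. Averaging over shifts \<open>t\<close> in the unit interval and exchanging
  integrals reduces the claim to slices, with no change of coordinates adapted to
  \<open>v\<close>.\<close>

lemma null_sets_lborel_if_lines:
  fixes N :: "'a::euclidean_space set"
  assumes N[measurable]: "N \<in> sets borel"
    and lines: "\<And>x. {t. x + t *\<^sub>R v \<in> N} \<in> null_sets lborel"
  shows "N \<in> null_sets lborel"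
proof -
  have "emeasure lborel N = (\<integral>\<^sup>+t. indicator {0..1::real} t * emeasure lborel N \<partial>lborel)"
    by (simp add: nn_integral_multc)
  also have "\<dots> = (\<integral>\<^sup>+t. (\<integral>\<^sup>+x. indicator {0..1::real} t * indicator N (x + t *\<^sub>R v) \<partial>lborel) \<partial>lborel)"
  proof (intro nn_integral_cong)
    fix t :: real
    have "emeasure lborel N = (\<integral>\<^sup>+x. indicator N (x + t *\<^sub>R v) \<partial>lborel)"
      by (subst nn_integral_lborel_translate) auto
    then show "indicator {0..1::real} t * emeasure lborel N =
      (\<integral>\<^sup>+x. indicator {0..1::real} t * indicator N (x + t *\<^sub>R v) \<partial>lborel)"
      by (simp add: nn_integral_cmult)
  qed
  also have "\<dots> = (\<integral>\<^sup>+x. (\<integral>\<^sup>+t. indicator {0..1::real} t * indicator N (x + t *\<^sub>R v) \<partial>lborel) \<partial>lborel)"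
    by (rule lborel_pair.Fubini') measurable
  also have "\<dots> = (\<integral>\<^sup>+x. 0 \<partial>(lborel :: 'a measure))"
  proof (intro nn_integral_cong)
    fix x :: 'a
    have "(\<integral>\<^sup>+t. indicator {0..1::real} t * indicator N (x + t *\<^sub>R v) \<partial>lborel) \<le>
        (\<integral>\<^sup>+t. indicator {t. x + t *\<^sub>R v \<in> N} t \<partial>lborel)"
      by (intro nn_integral_mono) (auto split: split_indicator)
    also have "\<dots> = 0" using lines[of x] by (auto simp: null_sets_def)
    finally show "(\<integral>\<^sup>+t. indicator {0..1::real} t * indicator N (x + t *\<^sub>R v) \<partial>lborel) = 0" by simp
  qed
  finally show ?thesis by (auto simp: null_sets_def)
qed

text \<open>On each line in direction \<open>v\<close>, the slice of the gap set is the gap set of a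
  one-dimensional Lipschitz function.\<close>

lemma derivate_gap_null:
  fixes f :: "'a::euclidean_space \<Rightarrow> real"
  assumes lip: "L-lipschitz_on UNIV f" and pq: "p < q"
  shows "derivate_gap f v p q \<in> null_sets lborel"
proof (rule null_sets_lborel_if_lines)
  show "derivate_gap f v p q \<in> sets borel"
    using lip by (auto intro!: derivate_gap_borel lipschitz_on_continuous_on)
  fix x
  have "(L * norm v)-lipschitz_on UNIV (\<lambda>t. f (x + t *\<^sub>R v))"
  proof (rule lipschitz_onI)
    fix s t :: real
    have "dist (f (x + s *\<^sub>R v)) (f (x + t *\<^sub>R v)) \<le> L * dist (x + s *\<^sub>R v) (x + t *\<^sub>R v)"
      by (rule lipschitz_onD[OF lip]) auto
    also have "dist (x + s *\<^sub>R v) (x + t *\<^sub>R v) = norm v * dist s t"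
      by (simp add: dist_norm flip: scaleR_diff_left)
    finally show "dist (f (x + s *\<^sub>R v)) (f (x + t *\<^sub>R v)) \<le> L * norm v * dist s t" by (simp add: mult_ac)
  qed (use lip in \<open>auto simp: lipschitz_on_def\<close>)
  then have "derivate_gap (\<lambda>t. f (x + t *\<^sub>R v)) 1 p q \<in> null_sets lborel"
    by (rule derivate_gap_null_real[OF _ pq])
  also have "derivate_gap (\<lambda>t. f (x + t *\<^sub>R v)) 1 p q = {t. x + t *\<^sub>R v \<in> derivate_gap f v p q}"
    by (simp add: derivate_gap_def scaleR_add_left add.assoc)
  finally show "{t. x + t *\<^sub>R v \<in> derivate_gap f v p q} \<in> null_sets lborel" .
qed

lemma lipschitz_quotient_bound:
  fixes f :: "'a::real_normed_vector \<Rightarrow> 'b::real_normed_vector"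
  assumes "L-lipschitz_on UNIV f"
  shows "norm ((f (x + t *\<^sub>R v) - f x) /\<^sub>R t) \<le> L * norm v"
proof (cases "t = 0")
  case False
  have "norm (f (x + t *\<^sub>R v) - f x) \<le> L * (\<bar>t\<bar> * norm v)"
    using lipschitz_onD[OF assms, of "x + t *\<^sub>R v" x] by (simp add: dist_norm)
  then have "inverse \<bar>t\<bar> * norm (f (x + t *\<^sub>R v) - f x) \<le> inverse \<bar>t\<bar> * (L * (\<bar>t\<bar> * norm v))"
    by (rule mult_left_mono) simp
  also have "\<dots> = L * norm v" using False by simp
  finally show ?thesis by (simp only: norm_scaleR abs_inverse)
qed (use lipschitz_on_nonneg[OF assms] in auto)

text \<open>The limit is taken along a fixed sequence of steps, so that measurability is immediate; it is
  the directional derivative only where the latter exists.\<close>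

definition dir_deriv :: "('a::real_normed_vector \<Rightarrow> real) \<Rightarrow> 'a \<Rightarrow> 'a \<Rightarrow> real" where
  "dir_deriv f v x = lim (\<lambda>k. (f (x + inverse (real (Suc k)) *\<^sub>R v) - f x) / inverse (real (Suc k)))"

lemma filterlim_inverse_Suc_at_0: "filterlim (\<lambda>k. inverse (real (Suc k))) (at 0) sequentially"
  unfolding filterlim_at using LIMSEQ_inverse_real_of_nat by auto

lemma dir_deriv_unique:
  assumes "((\<lambda>t. (f (x + t *\<^sub>R v) - f x) / t) \<longlongrightarrow> l) (at 0)"
  shows "dir_deriv f v x = l"
  unfolding dir_deriv_def
  by (rule limI, rule filterlim_compose[OF assms filterlim_inverse_Suc_at_0])

text \<open>Off the countably many gap sets with rational bounds, the lower and upper limits of the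
  quotients coincide, and the Lipschitz bound makes the common value finite.\<close>

lemma AE_dir_deriv:
  fixes f :: "'a::euclidean_space \<Rightarrow> real"
  assumes lip: "L-lipschitz_on UNIV f"
  shows "AE x in lborel. ((\<lambda>t. (f (x + t *\<^sub>R v) - f x) / t) \<longlongrightarrow> dir_deriv f v x) (at 0)"
proof -
  have "AE x in lborel. \<forall>r s :: rat. r < s \<longrightarrow> x \<notin> derivate_gap f v (of_rat r) (of_rat s)"
    unfolding AE_all_countable
  proof (intro allI)
    fix r s :: rat
    show "AE x in lborel. r < s \<longrightarrow> x \<notin> derivate_gap f v (of_rat r) (of_rat s)"
      by (cases "r < s") (auto intro!: AE_not_in derivate_gap_null[OF lip] simp: of_rat_less)
  qed
  then show ?thesis
  proof eventually_elim
    fix x assume gap: "\<forall>r s. r < s \<longrightarrow> x \<notin> derivate_gap f v (of_rat r) (of_rat s)"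
    define Q where "Q t = (f (x + t *\<^sub>R v) - f x) / t" for t
    define C where "C = L * norm v"
    have QC: "\<bar>Q t\<bar> \<le> C" for t
      using lipschitz_quotient_bound[OF lip, where x = x and t = t and v = v] by (simp add: Q_def C_def divide_inverse_commute)
    have gap: "\<not> (\<forall>d>0. \<exists>t. t \<noteq> 0 \<and> \<bar>t\<bar> < d \<and> Q t < of_rat r) \<or>
        \<not> (\<forall>d>0. \<exists>t. t \<noteq> 0 \<and> \<bar>t\<bar> < d \<and> of_rat s < Q t)" if "r < s" for r s
      using gap that by (simp add: derivate_gap_def Q_def)
    let ?I = "Liminf (at 0) (\<lambda>t. ereal (Q t))" and ?S = "Limsup (at 0) (\<lambda>t. ereal (Q t))"
    have "\<not> ?I < ?S"
    proof
      assume "?I < ?S"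
      \<comment> \<open>Two rationals are placed strictly between the lower and the upper limit;
        they witness membership in a gap set.\<close>
      then obtain r where r: "?I < ereal (of_rat r)" "ereal (of_rat r) < ?S"
        using ereal_dense3 by blast
      then obtain s where s: "ereal (of_rat r) < ereal (of_rat s)" "ereal (of_rat s) < ?S"
        using ereal_dense3 by blast
      have "\<exists>t. t \<noteq> 0 \<and> \<bar>t\<bar> < d \<and> Q t < of_rat r" if "0 < d" for d
      proof (rule ccontr)
        assume "\<not> ?thesis"
        then have "\<forall>\<^sub>F t in at 0. ereal (of_rat r) \<le> ereal (Q t)"
          using that unfolding eventually_at by (intro exI[of _ d]) (auto simp: not_less)
        then have "ereal (of_rat r) \<le> ?I" by (rule Liminf_bounded)
        with r show False by simp
      qed
      moreover have "\<exists>t. t \<noteq> 0 \<and> \<bar>t\<bar> < d \<and> of_rat s < Q t" if "0 < d" for d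
      proof (rule ccontr)
        assume "\<not> ?thesis"
        then have "\<forall>\<^sub>F t in at 0. ereal (Q t) \<le> ereal (of_rat s)"
          using that unfolding eventually_at by (intro exI[of _ d]) (auto simp: not_less)
        then have "?S \<le> ereal (of_rat s)" by (rule Limsup_bounded)
        with s show False by simp
      qed
      ultimately show False using gap[of r s] s by (auto simp: of_rat_less)
    qed
    moreover have "?I \<le> ?S" by (rule Liminf_le_Limsup) simp
    ultimately have eq: "?I = ?S" by simp
    have "ereal (- C) \<le> ?I" "?S \<le> ereal C"
      using QC by (auto intro!: Liminf_bounded Limsup_bounded always_eventually simp: abs_le_iff) (metis minus_le_iff)
    with eq have "ereal (- C) \<le> ?I" "?I \<le> ereal C" by simp_all
    then obtain l where l: "?I = ereal l"
    proof (cases ?I)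
      case PInf
      then show thesis using \<open>?I \<le> ereal C\<close> by simp
    next
      case MInf
      then show thesis using \<open>ereal (- C) \<le> ?I\<close> by simp
    qed
    then have "((\<lambda>t. ereal (Q t)) \<longlongrightarrow> ereal l) (at 0)"
      using eq by (intro Liminf_eq_Limsup) auto
    then have "(Q \<longlongrightarrow> l) (at 0)" by (simp add: lim_ereal)
    then show "((\<lambda>t. (f (x + t *\<^sub>R v) - f x) / t) \<longlongrightarrow> dir_deriv f v x) (at 0)"
      using dir_deriv_unique[where f = f and x = x and v = v and l = l] by (simp add: Q_def[abs_def])
  qed
qed

lemma dir_deriv_measurable:
  assumes "continuous_on UNIV f"
  shows "dir_deriv f v \<in> borel_measurable (borel :: 'a::euclidean_space measure)"
proof -
  have [measurable]: "f \<in> borel_measurable borel" using assms by (rule borel_measurable_continuous_onI)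
  show ?thesis unfolding dir_deriv_def[abs_def] by (rule borel_measurable_lim_metric) measurable
qed

section \<open>Additivity of directional derivatives\<close>

lemma integral_lborel_translate:
  fixes c :: "'a::euclidean_space" and f :: "'a \<Rightarrow> 'b::{banach, second_countable_topology}"
  assumes [measurable]: "f \<in> borel_measurable borel"
  shows "(\<integral>x. f (x + c) \<partial>lborel) = (\<integral>x. f x \<partial>lborel)"
proof -
  have "(\<integral>x. f x \<partial>lborel) = (\<integral>x. f x \<partial>distr lborel borel ((+) c))"
    by (simp add: lborel_distr_plus)
  also have "\<dots> = (\<integral>x. f (x + c) \<partial>lborel)"
    by (subst integral_distr) (auto simp: add.commute)
  finally show ?thesis by simp
qed

text \<open>Boxes are stable under intersection and generate the Borel sets, so a measure finite on
  boxes is determined by its values there; a density with respect to Lebesgue measure is then unique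
  almost everywhere.\<close>

lemma AE_eq_0_if_box_integrals_0:
  fixes g :: "'a::euclidean_space \<Rightarrow> real"
  assumes [measurable]: "g \<in> borel_measurable borel"
    and bound: "AE x in lborel. \<bar>g x\<bar> \<le> C"
    and boxes: "\<And>l u. (\<integral>x. indicator (box l u) x * g x \<partial>lborel) = 0"
  shows "AE x in lborel. g x = 0"
proof -
  define D where "D = max C 1"
  have D: "0 < D" by (simp add: D_def)
  have bD: "AE x in lborel. \<bar>g x\<bar> \<le> D"
    using bound by eventually_elim (simp add: D_def)
  \<comment> \<open>Shifting \<open>g\<close> by a constant makes it a density, determined by its values on boxes.\<close>
  define M where "M = density lborel (\<lambda>x. ennreal (D + g x))"
  define M' where "M' = density lborel (\<lambda>x::'a. ennreal D)"
  have emb: "emeasure M (box l u) = ennreal D * emeasure lborel (box l u)" for l u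
  proof -
    have int: "integrable lborel (\<lambda>x. indicator (box l u) x * D)"
      by (intro integrable_mult_left integrable_real_indicator) (auto simp: emeasure_lborel_box_eq)
    have intg: "integrable lborel (\<lambda>x. indicator (box l u) x * g x)"
      by (rule Bochner_Integration.integrable_bound[OF int])
        (use bD in \<open>auto split: split_indicator elim!: eventually_mono\<close>)
    have "emeasure M (box l u) = (\<integral>\<^sup>+x. ennreal (indicator (box l u) x * D + indicator (box l u) x * g x) \<partial>lborel)"
      unfolding M_def by (subst emeasure_density) (auto intro!: nn_integral_cong split: split_indicator)
    also have "\<dots> = ennreal (\<integral>x. indicator (box l u) x * D + indicator (box l u) x * g x \<partial>lborel)"
      using bD by (intro nn_integral_eq_integral Bochner_Integration.integrable_add int intg)
        (auto split: split_indicator elim!: eventually_mono)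
    also have "(\<integral>x. indicator (box l u) x * D + indicator (box l u) x * g x \<partial>lborel) = D * measure lborel (box l u)"
      by (subst Bochner_Integration.integral_add[OF int intg]) (simp add: boxes)
    also have "ennreal \<dots> = ennreal D * emeasure lborel (box l u)"
      using D by (subst emeasure_eq_ennreal_measure) (auto simp: ennreal_mult emeasure_lborel_box_eq)
    finally show ?thesis .
  qed
  have "M = M'"
  proof (rule measure_eqI_generator_eq[where E = "range (\<lambda>(l, u). box l u)" and \<Omega> = UNIV
        and A = "\<lambda>n. box (- (real n *\<^sub>R One)) (real n *\<^sub>R One)"])
    show "Int_stable (range (\<lambda>(l::'a, u). box l u))"
      by (auto simp: Int_stable_def box_Int_box)
    show "sets M = sigma_sets UNIV (range (\<lambda>(l, u). box l u))"
      "sets M' = sigma_sets UNIV (range (\<lambda>(l, u). box l u))"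
      by (simp_all add: M_def M'_def borel_eq_box image_def)
    show "(\<Union>n. box (- (real n *\<^sub>R One)) (real n *\<^sub>R One :: 'a)) = UNIV"
      by (rule UN_box_eq_UNIV)
    show "emeasure M X = emeasure M' X" if "X \<in> range (\<lambda>(l, u). box l u)" for X
      using that by (auto simp: emb M'_def emeasure_density nn_integral_cmult)
    show "emeasure M (box (- (real n *\<^sub>R One)) (real n *\<^sub>R One)) \<noteq> \<infinity>" for n
      by (simp add: emb ennreal_mult_eq_top_iff emeasure_lborel_box_eq)
  qed auto
  then have "AE x in lborel. ennreal (D + g x) = ennreal D"
    unfolding M_def M'_def
    by (subst (asm) sigma_finite_measure.density_unique_iff[OF lborel.sigma_finite_measure_axioms]) auto
  with bD show ?thesis
    by eventually_elim (use D in \<open>auto simp: abs_le_iff\<close>)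
qed

lemma dir_deriv_bound:
  assumes lip: "L-lipschitz_on UNIV f"
    and lim: "((\<lambda>t. (f (x + t *\<^sub>R v) - f x) / t) \<longlongrightarrow> dir_deriv f v x) (at 0)"
  shows "\<bar>dir_deriv f v x\<bar> \<le> L * norm v"
proof (rule tendsto_upperbound[OF tendsto_rabs[OF lim]])
  show "\<forall>\<^sub>F t in at 0. \<bar>(f (x + t *\<^sub>R v) - f x) / t\<bar> \<le> L * norm v"
    using lipschitz_quotient_bound[OF lip, where x = x and v = v]
    by (intro always_eventually allI) (simp add: divide_inverse_commute)
qed simp

text \<open>Split \<open>f (x + t (v + w)) - f x\<close> at \<open>x + t v\<close>; the integral of the first part over a box is an
  integral over the box translated by \<open>t v\<close>, which tends to the original box as \<open>t \<rightarrow> 0\<close>.\<close>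

lemma AE_dir_deriv_add:
  fixes f :: "'a::euclidean_space \<Rightarrow> real"
  assumes lip: "L-lipschitz_on UNIV f"
  shows "AE x in lborel. dir_deriv f (v + w) x = dir_deriv f v x + dir_deriv f w x"
proof -
  have cont: "continuous_on UNIV f" using lip by (rule lipschitz_on_continuous_on)
  have [measurable]: "f \<in> borel_measurable borel" using cont by (rule borel_measurable_continuous_onI)
  have [measurable]: "dir_deriv f z \<in> borel_measurable borel" for z
    using cont by (rule dir_deriv_measurable)
  define g where "g x = dir_deriv f (v + w) x - (dir_deriv f v x + dir_deriv f w x)" for x
  define \<tau> where "\<tau> k = inverse (real (Suc k))" for k
  have \<tau>: "\<tau> k \<noteq> 0" "\<bar>\<tau> k\<bar> \<le> 1" "0 < \<tau> k" for k by (auto simp: \<tau>_def field_simps)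
  have \<tau>0: "\<tau> \<longlonglongrightarrow> 0" unfolding \<tau>_def by (rule LIMSEQ_inverse_real_of_nat)
  define Q where "Q z k x = (f (x + \<tau> k *\<^sub>R z) - f x) / \<tau> k" for z k x
  have [measurable]: "Q z k \<in> borel_measurable borel" for z k unfolding Q_def[abs_def] by measurable
  have QL: "\<bar>Q z k x\<bar> \<le> L * norm z" for z k x
    using lipschitz_quotient_bound[OF lip, where x = x and t = "\<tau> k" and v = z] by (simp add: Q_def divide_inverse_commute)
  have Qlim: "AE x in lborel. (\<lambda>k. Q z k x) \<longlonglongrightarrow> dir_deriv f z x" for z
    using AE_dir_deriv[OF lip, of z]
  proof eventually_elim
    fix x assume "((\<lambda>t. (f (x + t *\<^sub>R z) - f x) / t) \<longlongrightarrow> dir_deriv f z x) (at 0)"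
    from filterlim_compose[OF this filterlim_inverse_Suc_at_0]
    show "(\<lambda>k. Q z k x) \<longlonglongrightarrow> dir_deriv f z x" by (simp add: Q_def \<tau>_def)
  qed
  have bnd: "AE x in lborel. \<bar>dir_deriv f z x\<bar> \<le> L * norm z" for z
    using AE_dir_deriv[OF lip, of z] by eventually_elim (rule dir_deriv_bound[OF lip])
  have box_int: "integrable lborel (\<lambda>x. indicator (box l u) x * h x)"
    if "h \<in> borel_measurable borel" "AE x in lborel. \<bar>h x\<bar> \<le> K" for h :: "'a \<Rightarrow> real" and K l u
  proof -
    have int: "integrable lborel (\<lambda>x. indicator (box l u) x * K)"
      by (intro integrable_mult_left integrable_real_indicator) (auto simp: emeasure_lborel_box_eq)
    show ?thesis
      by (rule Bochner_Integration.integrable_bound[OF int])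
        (use that in \<open>auto split: split_indicator elim!: eventually_mono\<close>)
  qed
  have "AE x in lborel. g x = 0"
  proof (rule AE_eq_0_if_box_integrals_0)
    show "g \<in> borel_measurable borel" unfolding g_def[abs_def] by measurable
    show "AE x in lborel. \<bar>g x\<bar> \<le> L * norm (v + w) + (L * norm v + L * norm w)"
      using bnd[of "v + w"] bnd[of v] bnd[of w] by eventually_elim (simp add: g_def)
    fix l u :: 'a
    let ?B = "indicator (box l u) :: 'a \<Rightarrow> real"
    obtain R where R: "0 < R" "box l u \<subseteq> cball 0 R"
      using bounded_box[of l u] unfolding bounded_pos by (auto simp: subset_iff)
    have lim: "(\<lambda>k. \<integral>x. ?B x * Q z k x \<partial>lborel) \<longlonglongrightarrow> (\<integral>x. ?B x * dir_deriv f z x \<partial>lborel)" for z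
    proof (rule integral_dominated_convergence[where w = "\<lambda>x. ?B x * (L * norm z)"])
      show "AE x in lborel. (\<lambda>k. ?B x * Q z k x) \<longlonglongrightarrow> ?B x * dir_deriv f z x"
        using Qlim[of z] by eventually_elim (intro tendsto_intros)
      show "AE x in lborel. norm (?B x * Q z k x) \<le> ?B x * (L * norm z)" for k
        using QL[of z k] by (auto split: split_indicator)
      show "integrable lborel (\<lambda>x. ?B x * (L * norm z))"
        by (rule box_int) auto
    qed auto
    have lim_shift: "(\<lambda>k. \<integral>x. ?B x * Q w k (x + \<tau> k *\<^sub>R v) \<partial>lborel) \<longlonglongrightarrow> (\<integral>x. ?B x * dir_deriv f w x \<partial>lborel)"
    proof -
      have "(\<integral>x. ?B x * Q w k (x + \<tau> k *\<^sub>R v) \<partial>lborel) = (\<integral>x. ?B (x - \<tau> k *\<^sub>R v) * Q w k x \<partial>lborel)" for k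
        using integral_lborel_translate[of "\<lambda>x. ?B (x - \<tau> k *\<^sub>R v) * Q w k x" "\<tau> k *\<^sub>R v"] by simp
      moreover have "(\<lambda>k. \<integral>x. ?B (x - \<tau> k *\<^sub>R v) * Q w k x \<partial>lborel) \<longlonglongrightarrow> (\<integral>x. ?B x * dir_deriv f w x \<partial>lborel)"
      proof (rule integral_dominated_convergence[where w = "\<lambda>x. indicator (cball 0 (R + norm v)) x * (L * norm w)"])
        \<comment> \<open>The indicator of a box is continuous off its frontier, which is null by
          convexity; hence the indicators of the shifted boxes converge almost everywhere.\<close>
        have "frontier (box l u) \<in> null_sets lebesgue"
          by (simp add: negligible_convex_frontier flip: negligible_iff_null_sets)
        then have "frontier (box l u) \<in> null_sets lborel"
          by (simp add: null_sets_completion_iff)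
        then have "AE x in lborel. x \<notin> frontier (box l u)" by (rule AE_not_in)
        with Qlim[of w] show "AE x in lborel. (\<lambda>k. ?B (x - \<tau> k *\<^sub>R v) * Q w k x) \<longlonglongrightarrow> ?B x * dir_deriv f w x"
        proof eventually_elim
          fix x assume 1: "(\<lambda>k. Q w k x) \<longlonglongrightarrow> dir_deriv f w x" and x: "x \<notin> frontier (box l u)"
          have sh: "(\<lambda>k. x - \<tau> k *\<^sub>R v) \<longlonglongrightarrow> x"
            using tendsto_diff[OF tendsto_const tendsto_scaleR[OF \<tau>0 tendsto_const], of x v] by simp
          have "isCont ?B x" using x by (simp add: isCont_indicator)
          from isCont_tendsto_compose[OF this sh] 1
          show "(\<lambda>k. ?B (x - \<tau> k *\<^sub>R v) * Q w k x) \<longlonglongrightarrow> ?B x * dir_deriv f w x"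
            by (rule tendsto_mult)
        qed
        \<comment> \<open>As \<open>\<bar>\<tau> k\<bar> \<le> 1\<close>, all shifted boxes lie in
          one ball of radius \<open>R + norm v\<close>, which supplies a dominating function
          independent of \<open>k\<close>.\<close>
        show "AE x in lborel. norm (?B (x - \<tau> k *\<^sub>R v) * Q w k x) \<le> indicator (cball 0 (R + norm v)) x * (L * norm w)" for k
        proof (rule AE_I2)
          fix x
          show "norm (?B (x - \<tau> k *\<^sub>R v) * Q w k x) \<le> indicator (cball 0 (R + norm v)) x * (L * norm w)"
          proof (cases "x - \<tau> k *\<^sub>R v \<in> box l u")
            case True
            then have "norm (x - \<tau> k *\<^sub>R v) \<le> R" using R by auto
            moreover have "norm (\<tau> k *\<^sub>R v) \<le> norm v"
              using \<tau>(2)[of k] by (simp add: mult_left_le_one_le)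
            ultimately have "norm x \<le> R + norm v"
              using norm_triangle_sub[of x "\<tau> k *\<^sub>R v"] by simp
            with True QL[of w k x] show ?thesis by simp
          qed (use lipschitz_on_nonneg[OF lip] in auto)
        qed
        show "integrable lborel (\<lambda>x. indicator (cball 0 (R + norm v)) x * (L * norm w))"
          by (intro integrable_mult_left integrable_real_indicator) (auto intro: emeasure_bounded_finite[unfolded infinity_ennreal_def])
      qed auto
      ultimately show ?thesis by simp
    qed
    have "(\<integral>x. ?B x * Q (v + w) k x \<partial>lborel) =
        (\<integral>x. ?B x * Q v k x \<partial>lborel) + (\<integral>x. ?B x * Q w k (x + \<tau> k *\<^sub>R v) \<partial>lborel)" for k
    proof -
      have "Q (v + w) k x = Q v k x + Q w k (x + \<tau> k *\<^sub>R v)" for x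
        by (simp add: Q_def scaleR_add_right add.assoc diff_divide_distrib)
      moreover have "integrable lborel (\<lambda>x. ?B x * Q v k x)"
        by (rule box_int[where K = "L * norm v"]) (use QL in auto)
      moreover have "integrable lborel (\<lambda>x. ?B x * Q w k (x + \<tau> k *\<^sub>R v))"
        by (rule box_int[where K = "L * norm w"]) (use QL in auto)
      ultimately show ?thesis
        by (simp add: distrib_left)
    qed
    with lim[of "v + w"] have "(\<lambda>k. (\<integral>x. ?B x * Q v k x \<partial>lborel) + (\<integral>x. ?B x * Q w k (x + \<tau> k *\<^sub>R v) \<partial>lborel))
        \<longlonglongrightarrow> (\<integral>x. ?B x * dir_deriv f (v + w) x \<partial>lborel)" by simp
    from LIMSEQ_unique[OF this tendsto_add[OF lim[of v] lim_shift]]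
    show "(\<integral>x. ?B x * g x \<partial>lborel) = 0"
      using box_int[OF _ bnd]
      by (simp add: g_def right_diff_distrib distrib_left)
  qed
  then show ?thesis by eventually_elim (simp add: g_def)
qed

section \<open>Rademacher's theorem\<close>

text \<open>\<open>dir_deriv\<close> samples one sequence of steps, and scaling \<open>v\<close>
  changes that sequence. Existence of the full limit makes the value insensitive to this;
  \<open>c = 0\<close> is separate because the substitution \<open>t * c\<close> must avoid
  0.\<close>

lemma dir_deriv_scaleR:
  assumes lim: "((\<lambda>t. (f (x + t *\<^sub>R v) - f x) / t) \<longlongrightarrow> dir_deriv f v x) (at 0)"
  shows "dir_deriv f (c *\<^sub>R v) x = c * dir_deriv f v x"
proof (cases "c = 0")
  case True
  then show ?thesis by (auto intro: dir_deriv_unique)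
next
  case False
  have "filterlim (\<lambda>t. t * c) (at 0) (at 0)"
    unfolding filterlim_at using False
    by (auto simp: eventually_at_filter intro!: tendsto_eq_intros)
  from tendsto_mult_left[OF filterlim_compose[OF lim this], of c] False
  show ?thesis by (intro dir_deriv_unique) simp
qed

text \<open>The exceptional null set depends on the coefficients \<open>c\<close>, so this can be
  used for only countably many vectors at once.\<close>

lemma AE_dir_deriv_sum:
  fixes f :: "'a::euclidean_space \<Rightarrow> real"
  assumes lip: "L-lipschitz_on UNIV f" and "finite B"
  shows "AE x in lborel. dir_deriv f (\<Sum>b\<in>B. c b *\<^sub>R b) x = (\<Sum>b\<in>B. c b * dir_deriv f b x)"
  using \<open>finite B\<close>
proof induction
  case empty
  then show ?case by (auto intro!: dir_deriv_unique)
next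
  case (insert b B)
  show ?case
    using insert.IH AE_dir_deriv[OF lip, of b] AE_dir_deriv_add[OF lip, of "c b *\<^sub>R b" "\<Sum>b\<in>B. c b *\<^sub>R b"]
    by eventually_elim (use insert.hyps in \<open>simp add: dir_deriv_scaleR\<close>)
qed

text \<open>By compactness, finitely many directions in \<open>D\<close> approximate the whole unit
  sphere, and along these the quotients converge uniformly. The Lipschitz bounds of \<open>f\<close>
  and \<open>A\<close> carry the estimate to every other direction.\<close>

lemma has_derivative_if_dense_directions:
  fixes f :: "'a::euclidean_space \<Rightarrow> real"
  assumes lip: "L-lipschitz_on UNIV f" and A: "linear A"
    and dense: "\<And>X. open X \<Longrightarrow> X \<noteq> {} \<Longrightarrow> \<exists>d\<in>D. d \<in> X"
    and lim: "\<And>v. v \<in> D \<Longrightarrow> ((\<lambda>t. (f (x + t *\<^sub>R v) - f x) / t) \<longlongrightarrow> A v) (at 0)"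
  shows "(f has_derivative A) (at x)"
  unfolding has_derivative_at_alt
proof (intro conjI allI impI)
  show "bounded_linear A" using A by (simp add: linear_conv_bounded_linear)
  fix e :: real assume e: "0 < e"
  have L: "0 \<le> L" using lip by (rule lipschitz_on_nonneg)
  obtain K where K: "0 < K" "\<And>v. norm (A v) \<le> K * norm v"
    using linear_bounded_pos[OF A] by blast
  \<comment> \<open>Three errors add up to \<open>e\<close>: \<open>L * \<eta>\<close> for replacing
    the direction in \<open>f\<close>, \<open>\<eta>\<close> for the quotient there, and
    \<open>K * \<eta>\<close> for replacing the direction in \<open>A\<close>.\<close>
  define \<eta> where "\<eta> = e / (1 + L + K)"
  have \<eta>: "0 < \<eta>" "(1 + L + K) * \<eta> = e" using e L K by (auto simp: \<eta>_def)
  have "sphere 0 1 \<subseteq> (\<Union>q\<in>D. ball q \<eta>)"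
  proof
    fix u :: 'a
    obtain q where "q \<in> D" "q \<in> ball u \<eta>" using dense[of "ball u \<eta>"] \<eta> by auto
    then show "u \<in> (\<Union>q\<in>D. ball q \<eta>)" by (auto simp: dist_commute)
  qed
  then obtain C where C: "C \<subseteq> D" "finite C" "sphere 0 1 \<subseteq> (\<Union>q\<in>C. ball q \<eta>)"
    using compactE_image[OF compact_sphere, of D "\<lambda>q. ball q \<eta>" 0 1] open_ball by metis
  have "\<forall>q\<in>C. \<forall>\<^sub>F t in at 0. dist ((f (x + t *\<^sub>R q) - f x) / t) (A q) < \<eta>"
    using C lim \<eta> by (auto intro!: tendstoD)
  then have "\<forall>\<^sub>F t in at 0. \<forall>q\<in>C. dist ((f (x + t *\<^sub>R q) - f x) / t) (A q) < \<eta>"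
    using C by (intro eventually_ball_finite) auto
  then obtain d where d: "0 < d"
    "\<And>t q. t \<noteq> 0 \<Longrightarrow> \<bar>t\<bar> < d \<Longrightarrow> q \<in> C \<Longrightarrow> dist ((f (x + t *\<^sub>R q) - f x) / t) (A q) < \<eta>"
    unfolding eventually_at by auto
  show "\<exists>d>0. \<forall>y. norm (y - x) < d \<longrightarrow> norm (f y - f x - A (y - x)) \<le> e * norm (y - x)"
  proof (intro exI conjI allI impI)
    fix y assume y: "norm (y - x) < d"
    show "norm (f y - f x - A (y - x)) \<le> e * norm (y - x)"
    proof (cases "y = x")
      case True
      then show ?thesis using linear_0[OF A] by simp
    next
      case False
      define t where "t = norm (y - x)"
      define u where "u = (y - x) /\<^sub>R t"
      have t: "0 < t" "t < d" using False y by (auto simp: t_def)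
      have u: "norm u = 1" "y = x + t *\<^sub>R u" using t False by (auto simp: u_def t_def)
      obtain q where q: "q \<in> C" "norm (u - q) < \<eta>"
        using C(3) u(1) by (auto simp: subset_iff dist_norm norm_minus_commute)
      have 1: "\<bar>f (x + t *\<^sub>R u) - f (x + t *\<^sub>R q)\<bar> \<le> t * (L * \<eta>)"
      proof -
        have "\<bar>f (x + t *\<^sub>R u) - f (x + t *\<^sub>R q)\<bar> \<le> L * dist (x + t *\<^sub>R u) (x + t *\<^sub>R q)"
          using lipschitz_onD[OF lip, of "x + t *\<^sub>R u" "x + t *\<^sub>R q"] by (simp add: dist_real_def)
        also have "dist (x + t *\<^sub>R u) (x + t *\<^sub>R q) = t * norm (u - q)"
          using t by (simp add: dist_norm flip: scaleR_diff_right)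
        also have "L * (t * norm (u - q)) \<le> L * (t * \<eta>)"
          using q t L by (intro mult_left_mono) auto
        finally show ?thesis by (simp add: mult_ac)
      qed
      have 2: "\<bar>f (x + t *\<^sub>R q) - f x - t * A q\<bar> \<le> t * \<eta>"
      proof -
        have "f (x + t *\<^sub>R q) - f x - t * A q = t * ((f (x + t *\<^sub>R q) - f x) / t - A q)"
          using t by (simp add: field_simps)
        then have "\<bar>f (x + t *\<^sub>R q) - f x - t * A q\<bar> = t * \<bar>(f (x + t *\<^sub>R q) - f x) / t - A q\<bar>"
          using t by (simp only: abs_mult)
        also have "\<dots> \<le> t * \<eta>"
          using d(2)[of t q] t q by (intro mult_left_mono) (auto simp: dist_real_def)
        finally show ?thesis .
      qed
      have 3: "\<bar>t * A q - t * A u\<bar> \<le> t * (K * \<eta>)"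
      proof -
        have "\<bar>t * A q - t * A u\<bar> = t * \<bar>A (u - q)\<bar>"
          using t by (simp add: linear_diff[OF A] abs_mult abs_minus_commute flip: right_diff_distrib)
        also have "\<dots> \<le> t * (K * \<eta>)"
        proof (intro mult_left_mono)
          have "\<bar>A (u - q)\<bar> \<le> K * norm (u - q)" using K(2)[of "u - q"] by simp
          also have "\<dots> \<le> K * \<eta>" using q K by simp
          finally show "\<bar>A (u - q)\<bar> \<le> K * \<eta>" .
        qed (use t in auto)
        finally show ?thesis .
      qed
      have "A (y - x) = t * A u" using linear_scale[OF A] u by simp
      then have "\<bar>f y - f x - A (y - x)\<bar> \<le> t * (L * \<eta>) + t * \<eta> + t * (K * \<eta>)"
        using 1 2 3 unfolding u(2) by linarith
      also have "\<dots> = e * t" unfolding \<eta>(2)[symmetric] by (simp add: algebra_simps)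
      finally show ?thesis by (simp add: t_def)
    qed
  qed (rule d)
qed

text \<open>A countable dense set of directions keeps the exceptional set null. At the remaining
  points the directional derivatives agree on it with the linear map built from those along
  \<open>Basis\<close>.\<close>

lemma rademacher_real:
  fixes f :: "'a::euclidean_space \<Rightarrow> real"
  assumes lip: "L-lipschitz_on UNIV f"
  shows "AE x in lborel. f differentiable (at x)"
proof -
  obtain D :: "'a set" where D: "countable D" "\<And>X. open X \<Longrightarrow> X \<noteq> {} \<Longrightarrow> \<exists>d\<in>D. d \<in> X"
    using countable_dense_setE by blast
  have "AE x in lborel. \<forall>v\<in>D. ((\<lambda>t. (f (x + t *\<^sub>R v) - f x) / t) \<longlongrightarrow> dir_deriv f v x) (at 0) \<and>
      dir_deriv f (\<Sum>b\<in>Basis. (v \<bullet> b) *\<^sub>R b) x = (\<Sum>b\<in>Basis. (v \<bullet> b) * dir_deriv f b x)"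
    using AE_dir_deriv[OF lip] AE_dir_deriv_sum[OF lip finite_Basis]
    by (subst AE_ball_countable[OF D(1)]) auto
  then show ?thesis
  proof eventually_elim
    fix x
    assume *: "\<forall>v\<in>D. ((\<lambda>t. (f (x + t *\<^sub>R v) - f x) / t) \<longlongrightarrow> dir_deriv f v x) (at 0) \<and>
      dir_deriv f (\<Sum>b\<in>Basis. (v \<bullet> b) *\<^sub>R b) x = (\<Sum>b\<in>Basis. (v \<bullet> b) * dir_deriv f b x)"
    define A where "A v = (\<Sum>b\<in>Basis. (v \<bullet> b) * dir_deriv f b x)" for v
    have "linear A"
      by (rule linearI) (simp_all add: A_def inner_add_left distrib_right sum.distrib sum_distrib_left mult.assoc)
    then have "(f has_derivative A) (at x)"
      using * by (intro has_derivative_if_dense_directions[OF lip _ D(2)]) (auto simp: euclidean_representation A_def)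
    then show "f differentiable (at x)" by (auto simp: differentiable_def)
  qed
qed

theorem rademacher:
  fixes f :: "'a::euclidean_space \<Rightarrow> 'b::euclidean_space"
  assumes lip: "L-lipschitz_on UNIV f"
  shows "AE x in lborel. f differentiable (at x)"
proof -
  have "AE x in lborel. (\<lambda>y. f y \<bullet> i) differentiable (at x)" if "i \<in> Basis" for i
  proof (rule rademacher_real)
    show "L-lipschitz_on UNIV (\<lambda>y. f y \<bullet> i)"
    proof (rule lipschitz_onI)
      fix x y
      have "dist (f x \<bullet> i) (f y \<bullet> i) \<le> dist (f x) (f y)"
        using Basis_le_norm[OF that, of "f x - f y"] by (simp add: dist_norm inner_diff_left)
      also have "\<dots> \<le> L * dist x y" by (rule lipschitz_onD[OF lip]) auto
      finally show "dist (f x \<bullet> i) (f y \<bullet> i) \<le> L * dist x y" .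
    qed (use lipschitz_on_nonneg[OF lip] in auto)
  qed
  then have "AE x in lborel. \<forall>i\<in>Basis. (\<lambda>y. f y \<bullet> i) differentiable (at x)"
    by (intro AE_finite_allI) auto
  then show ?thesis
    by eventually_elim (subst differentiable_componentwise_within, simp)
qed

section \<open>A mean value inequality\<close>

lemma AE_lborel_translate:
  fixes c :: "'a::euclidean_space"
  assumes "AE x in lborel. P x"
  shows "AE x in lborel. P (x + c)"
proof -
  have "AE x in distr lborel borel ((+) c). P x"
    using assms unfolding lborel_distr_plus .
  then have "AE x in lborel. P (c + x)" by (rule AE_distrD[rotated]) simp
  then show ?thesis by (simp add: add.commute)
qed

text \<open>Averaging over a small ball makes the increment differentiable in the step, so that the
  classical mean value theorem applies to the average.\<close>

lemma lipschitz_mvt_AE: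
  fixes h :: "'a::euclidean_space \<Rightarrow> real"
  assumes lip: "L-lipschitz_on UNIV h" and P: "AE y in lborel. P y"
    and t: "0 < t" and c: "c * t < h (x + t *\<^sub>R v) - h x" and \<delta>: "0 < \<delta>"
  obtains s y where "0 < s" "s < t" "dist y (x + s *\<^sub>R v) < \<delta>" "P y" "c < dir_deriv h v y"
proof -
  have cont: "continuous_on S h" for S
    using lip lipschitz_on_continuous_on continuous_on_subset by blast
  have [measurable]: "h \<in> borel_measurable borel" using cont by (rule borel_measurable_continuous_onI)
  have [measurable]: "dir_deriv h v \<in> borel_measurable borel"
    using cont by (rule dir_deriv_measurable)
  have "c < (h (x + t *\<^sub>R v) - h x) / t"
    using c t by (simp only: pos_less_divide_eq)
  \<comment> \<open>The gap between \<open>c\<close> and \<open>c'\<close> lets the increment bound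
    hold with \<open>c'\<close> on a whole ball around \<open>x\<close>, while the final
    contradiction stays strict.\<close>
  then obtain c' where "c < c'" "c' < (h (x + t *\<^sub>R v) - h x) / t" using dense by blast
  then have c': "c < c'" "c' * t < h (x + t *\<^sub>R v) - h x"
    using t by (simp_all only: pos_less_divide_eq)
  have "isCont (\<lambda>z. h (z + t *\<^sub>R v) - h z) x"
    using cont by (intro continuous_on_interior[of UNIV] continuous_intros continuous_on_compose2[OF cont[of UNIV]]) auto
  then have "\<forall>\<^sub>F z in nhds x. c' * t < h (z + t *\<^sub>R v) - h z"
    unfolding isCont_def tendsto_at_iff_tendsto_nhds[where g = "\<lambda>z. h (z + t *\<^sub>R v) - h z"]
    by (rule order_tendstoD(1)[OF _ c'(2)])
  then obtain r0 where r0: "0 < r0" "\<And>z. dist z x < r0 \<Longrightarrow> c' * t < h (z + t *\<^sub>R v) - h z"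
    unfolding eventually_nhds_metric by blast
  define r where "r = min r0 \<delta> / 2"
  have r: "0 < r" "r < r0" "r < \<delta>" using r0 \<delta> by (auto simp: r_def)
  define V where "V = cball x r"
  have [measurable]: "V \<in> sets borel" by (simp add: V_def)
  \<comment> \<open>\<open>F s\<close> integrates \<open>h\<close> over the ball translated by
    \<open>s *\<^sub>R v\<close>; \<open>G\<close> is the candidate for its derivative.\<close>
  define F where "F s = (\<integral>y. indicator V y * h (y + s *\<^sub>R v) \<partial>lborel)" for s
  define G where "G s = (\<integral>y. indicator V y * dir_deriv h v (y + s *\<^sub>R v) \<partial>lborel)" for s
  have int: "integrable lborel (\<lambda>y. indicator V y * h (y + s *\<^sub>R v))" for s
    using borel_integrable_compact[of V "\<lambda>y. h (y + s *\<^sub>R v)"]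
    by (simp add: V_def continuous_on_compose2[OF cont[of UNIV]] continuous_intros)
  have intc: "integrable lborel (\<lambda>y. indicator V y * K)" for K :: real
    using borel_integrable_compact[of V "\<lambda>y. K"] by (simp add: V_def)
  have QL: "\<bar>(h (y + \<eta> *\<^sub>R v) - h y) / \<eta>\<bar> \<le> L * norm v" for y \<eta>
    using lipschitz_quotient_bound[OF lip, where x = y and t = \<eta> and v = v] by (simp add: divide_inverse_commute)
  have dd: "AE y in lborel. ((\<lambda>\<eta>. (h (y + s *\<^sub>R v + \<eta> *\<^sub>R v) - h (y + s *\<^sub>R v)) / \<eta>) \<longlongrightarrow> dir_deriv h v (y + s *\<^sub>R v)) (at 0)" for s
    by (rule AE_lborel_translate[OF AE_dir_deriv[OF lip]])
  \<comment> \<open>Quotients of \<open>F\<close> are integrals of quotients of \<open>h\<close>,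
    which converge almost everywhere and are bounded by \<open>L * norm v\<close>, so dominated
    convergence applies along every null sequence.\<close>
  have "DERIV F s :> G s" for s
    unfolding DERIV_def tendsto_at_iff_sequentially comp_def
  proof (intro allI impI)
    fix \<eta> :: "nat \<Rightarrow> real" assume \<eta>: "\<forall>i. \<eta> i \<in> UNIV - {0}" "\<eta> \<longlonglongrightarrow> 0"
    have "(F (s + \<eta> k) - F s) / \<eta> k =
        (\<integral>y. indicator V y * ((h (y + s *\<^sub>R v + \<eta> k *\<^sub>R v) - h (y + s *\<^sub>R v)) / \<eta> k) \<partial>lborel)" for k
      unfolding F_def Bochner_Integration.integral_diff[OF int int, symmetric]
      by (subst integral_divide_zero[symmetric]) (auto simp: scaleR_add_left add.assoc right_diff_distrib diff_divide_distrib)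
    moreover have "(\<lambda>k. \<integral>y. indicator V y * ((h (y + s *\<^sub>R v + \<eta> k *\<^sub>R v) - h (y + s *\<^sub>R v)) / \<eta> k) \<partial>lborel) \<longlonglongrightarrow> G s"
      unfolding G_def
    proof (rule integral_dominated_convergence[where w = "\<lambda>y. indicator V y * (L * norm v)"])
      show "AE y in lborel. (\<lambda>k. indicator V y * ((h (y + s *\<^sub>R v + \<eta> k *\<^sub>R v) - h (y + s *\<^sub>R v)) / \<eta> k))
          \<longlonglongrightarrow> indicator V y * dir_deriv h v (y + s *\<^sub>R v)"
        using dd[of s]
      proof eventually_elim
        fix y assume *: "((\<lambda>\<eta>. (h (y + s *\<^sub>R v + \<eta> *\<^sub>R v) - h (y + s *\<^sub>R v)) / \<eta>) \<longlongrightarrow> dir_deriv h v (y + s *\<^sub>R v)) (at 0)"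
        have "filterlim \<eta> (at 0) sequentially" using \<eta> by (auto simp: filterlim_at)
        from filterlim_compose[OF * this]
        show "(\<lambda>k. indicator V y * ((h (y + s *\<^sub>R v + \<eta> k *\<^sub>R v) - h (y + s *\<^sub>R v)) / \<eta> k))
          \<longlonglongrightarrow> indicator V y * dir_deriv h v (y + s *\<^sub>R v)" by (rule tendsto_mult_left)
      qed
      show "AE y in lborel. norm (indicator V y * ((h (y + s *\<^sub>R v + \<eta> k *\<^sub>R v) - h (y + s *\<^sub>R v)) / \<eta> k))
          \<le> indicator V y * (L * norm v)" for k
        using QL by (intro AE_I2) (auto split: split_indicator)
    qed (use intc in auto)
    ultimately show "(\<lambda>k. (F (s + \<eta> k) - F s) / \<eta> k) \<longlonglongrightarrow> G s" by (simp only:)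
  qed
  then obtain s where s: "0 < s" "s < t" "F t - F 0 = t * G s"
    using MVT2[OF t, of F G] by auto
  show thesis
  proof (rule ccontr)
    note found = that
    assume "\<not> thesis"
    \<comment> \<open>Without a suitable point the integrand of \<open>G s\<close> is at most
      \<open>c\<close> almost everywhere on \<open>V\<close>, so
      \<open>F t - F 0 \<le> t * (m * c)\<close>; the pointwise increments give at least
      \<open>m * (c' * t)\<close>.\<close>
    then have no: "dir_deriv h v y \<le> c" if y: "dist y (x + s *\<^sub>R v) < \<delta>" "P y" for y
      using found[OF s(1,2) y] by (meson not_le)
    define m where "m = measure lborel V"
    have m: "0 < m" using r content_cball_pos[of r x] by (simp add: m_def V_def)
    have intcm: "(\<integral>y. indicator V y * K \<partial>lborel) = m * K" for K :: real
      by (simp add: m_def)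
    have "AE y in lborel. \<bar>dir_deriv h v (y + s *\<^sub>R v)\<bar> \<le> L * norm v"
      using dd[of s] by eventually_elim (rule dir_deriv_bound[OF lip])
    then have intd: "integrable lborel (\<lambda>y. indicator V y * dir_deriv h v (y + s *\<^sub>R v))"
      by (intro Bochner_Integration.integrable_bound[OF intc[of "L * norm v"]])
        (auto split: split_indicator elim!: eventually_mono)
    have "G s \<le> (\<integral>y. indicator V y * c \<partial>lborel)"
      unfolding G_def
    proof (rule integral_mono_AE[OF intd intc])
      show "AE y in lborel. indicator V y * dir_deriv h v (y + s *\<^sub>R v) \<le> indicator V y * c"
        using AE_lborel_translate[OF P, of "s *\<^sub>R v"]
      proof eventually_elim
        fix y assume "P (y + s *\<^sub>R v)"
        then show "indicator V y * dir_deriv h v (y + s *\<^sub>R v) \<le> indicator V y * c"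
          using no[of "y + s *\<^sub>R v"] r by (auto simp: V_def dist_commute split: split_indicator)
      qed
    qed
    then have "F t - F 0 \<le> t * (m * c)" using s t by (simp add: m_def)
    moreover have "(\<integral>y. indicator V y * (c' * t) \<partial>lborel) \<le> F t - F 0"
      unfolding F_def Bochner_Integration.integral_diff[OF int int, symmetric]
    proof (rule integral_mono[OF intc Bochner_Integration.integrable_diff[OF int int]])
      fix y
      show "indicator V y * (c' * t) \<le> indicator V y * h (y + t *\<^sub>R v) - indicator V y * h (y + 0 *\<^sub>R v)"
        using r0(2)[of y] r by (auto simp: V_def dist_commute split: split_indicator)
    qed
    ultimately have "m * (c' * t) \<le> t * (m * c)" unfolding intcm by simp
    with m t c' show False by (simp add: mult_less_cancel_left mult_ac)
  qed
qed

section \<open>Perturbation of the generalized Jacobian\<close>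

text \<open>The generating set before the convex hull, known as the Bouligand or limiting
  Jacobian.\<close>

definition jacobian_limits :: "(real^'n \<Rightarrow> real^'n) \<Rightarrow> real^'n \<Rightarrow> (real^'n^'n) set" where
  "jacobian_limits f x0 =
     {M. \<exists>X :: nat \<Rightarrow> real^'n. X \<longlonglongrightarrow> x0 \<and> (\<forall>i. f differentiable (at (X i))) \<and>
                       (\<lambda>i. jacobian f (at (X i))) \<longlonglongrightarrow> M}"

lemma generalized_jacobian_eq: "generalized_jacobian f x0 = convex hull jacobian_limits f x0"
  by (simp add: generalized_jacobian_def jacobian_limits_def)

lemma tendsto_inner_quotient:
  fixes f :: "real^'n \<Rightarrow> real^'m"
  assumes "f differentiable (at y)"
  shows "((\<lambda>t. (u \<bullet> f (y + t *\<^sub>R v) - u \<bullet> f y) / t) \<longlongrightarrow> u \<bullet> (jacobian f (at y) *v v)) (at 0)"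
proof -
  have "(f has_derivative (\<lambda>h. jacobian f (at y) *v h)) (at (y + 0 *\<^sub>R v))"
    using assms by (simp add: jacobian_works)
  then have "((\<lambda>t. u \<bullet> f (y + t *\<^sub>R v)) has_derivative (\<lambda>t. u \<bullet> (jacobian f (at y) *v (t *\<^sub>R v)))) (at 0)"
    by (intro has_derivative_inner_right has_derivative_compose[of "\<lambda>t. y + t *\<^sub>R v" _ 0 UNIV f])
      (auto intro!: derivative_eq_intros)
  then have "((\<lambda>t. u \<bullet> f (y + t *\<^sub>R v)) has_field_derivative u \<bullet> (jacobian f (at y) *v v)) (at 0)"
    unfolding has_field_derivative_def
    by (rule has_derivative_eq_rhs) (auto simp: matrix_vector_mult_scaleR)
  then show ?thesis by (simp add: DERIV_def)
qed

lemma dir_deriv_inner: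
  fixes f :: "real^'n \<Rightarrow> real^'m"
  assumes "f differentiable (at y)"
  shows "dir_deriv (\<lambda>z. u \<bullet> f z) v y = u \<bullet> (jacobian f (at y) *v v)"
  by (rule dir_deriv_unique[OF tendsto_inner_quotient[OF assms]])

lemma lipschitz_on_inner:
  fixes f :: "'a::metric_space \<Rightarrow> 'b::real_inner"
  assumes "L-lipschitz_on S f"
  shows "(norm u * L)-lipschitz_on S (\<lambda>z. u \<bullet> f z)"
proof (rule lipschitz_onI)
  fix x y assume "x \<in> S" "y \<in> S"
  have "dist (u \<bullet> f x) (u \<bullet> f y) \<le> norm u * dist (f x) (f y)"
    using Cauchy_Schwarz_ineq2[of u "f x - f y"] by (simp add: dist_norm inner_diff_right)
  also have "\<dots> \<le> norm u * (L * dist x y)"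
    using lipschitz_onD[OF assms \<open>x \<in> S\<close> \<open>y \<in> S\<close>] by (rule mult_left_mono) simp
  finally show "dist (u \<bullet> f x) (u \<bullet> f y) \<le> norm u * L * dist x y" by (simp add: mult_ac)
qed (use lipschitz_on_nonneg[OF assms] in auto)

text \<open>Testing against \<open>w\<close>, the image vector itself, turns the scalar bound on
  directional derivatives into a bound on \<open>norm w\<close>.\<close>

lemma norm_jacobian_mult_le:
  fixes f :: "real^'n \<Rightarrow> real^'m"
  assumes lip: "L-lipschitz_on UNIV f" and diff: "f differentiable (at y)"
  shows "norm (jacobian f (at y) *v v) \<le> L * norm v"
proof -
  define w where "w = jacobian f (at y) *v v"
  have "\<bar>dir_deriv (\<lambda>z. w \<bullet> f z) v y\<bar> \<le> norm w * L * norm v"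
    by (rule dir_deriv_bound[OF lipschitz_on_inner[OF lip]])
      (simp add: dir_deriv_inner[OF diff] tendsto_inner_quotient[OF diff])
  then have "norm w * norm w \<le> norm w * (L * norm v)"
    by (simp add: dir_deriv_inner[OF diff] w_def[symmetric] norm_eq_sqrt_inner mult_ac)
  then have "norm w \<le> L * norm v"
    using lipschitz_on_nonneg[OF lip] by (cases "w = 0") auto
  then show ?thesis by (simp add: w_def)
qed

text \<open>The constant is crude; its purpose is to bound Jacobians uniformly. Each entry is
  controlled by applying \<open>A\<close> to a coordinate vector.\<close>

lemma norm_matrix_le:
  fixes A :: "real^'n^'m"
  assumes "\<And>v. norm (A *v v) \<le> L * norm v"
  shows "norm A \<le> real CARD('m) * (real CARD('n) * L)"
proof -
  have "\<bar>A $ i $ j\<bar> \<le> L" for i j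
  proof -
    have "\<bar>A $ i $ j\<bar> = \<bar>(A *v axis j 1) $ i\<bar>" by (simp add: matrix_vector_mult_basis column_def)
    also have "\<dots> \<le> norm (A *v axis j 1)" by (rule component_le_norm_cart)
    also have "\<dots> \<le> L" using assms[of "axis j 1"] by simp
    finally show ?thesis .
  qed
  then have "(\<Sum>j\<in>UNIV. \<bar>A $ i $ j\<bar>) \<le> real CARD('n) * L" for i
    by (rule sum_bounded_above)
  then have "norm (A $ i) \<le> real CARD('n) * L" for i
    using norm_le_l1_cart order_trans by blast
  then have "(\<Sum>i\<in>UNIV. norm (A $ i)) \<le> real CARD('m) * (real CARD('n) * L)"
    by (rule sum_bounded_above)
  moreover have "norm A \<le> (\<Sum>i\<in>UNIV. norm (A $ i))"
    unfolding norm_vec_def by (rule L2_set_le_sum) simp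
  ultimately show ?thesis by simp
qed

text \<open>This form makes closedness immediate. For the converse inclusion one point is chosen for
  each \<open>n\<close>, within \<open>inverse (real (Suc n))\<close> both in position and in
  Jacobian.\<close>

lemma jacobian_limits_eq_INT_closure:
  "jacobian_limits f x0 =
     (\<Inter>n. closure {jacobian f (at y) | y. dist y x0 < inverse (real (Suc n)) \<and> f differentiable (at y)})"
    (is "_ = (\<Inter>n. closure (?S n))")
proof (intro equalityI subsetI)
  fix M assume "M \<in> jacobian_limits f x0"
  then obtain X where X: "X \<longlonglongrightarrow> x0" "\<And>i. f differentiable (at (X i))"
    "(\<lambda>i. jacobian f (at (X i))) \<longlonglongrightarrow> M" by (auto simp: jacobian_limits_def)
  have "M \<in> closure (?S n)" for n
  proof (rule Lim_in_closed_set[OF closed_closure _ _ X(3)])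
    have "\<forall>\<^sub>F i in sequentially. dist (X i) x0 < inverse (real (Suc n))"
      by (rule tendstoD[OF X(1)]) simp
    then show "\<forall>\<^sub>F i in sequentially. jacobian f (at (X i)) \<in> closure (?S n)"
      by eventually_elim (use X(2) in \<open>auto intro!: subsetD[OF closure_subset]\<close>)
  qed simp
  then show "M \<in> (\<Inter>n. closure (?S n))" by blast
next
  fix M assume M: "M \<in> (\<Inter>n. closure (?S n))"
  have "\<exists>y. dist y x0 < inverse (real (Suc n)) \<and> f differentiable (at y) \<and>
      dist (jacobian f (at y)) M < inverse (real (Suc n))" for n
  proof -
    have "M \<in> closure (?S n)" using M by blast
    moreover have "0 < inverse (real (Suc n))" by simp
    ultimately have "\<exists>N\<in>?S n. dist N M < inverse (real (Suc n))"
      unfolding closure_approachable by blast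
    then show ?thesis by blast
  qed
  then obtain X where X: "\<And>n. dist (X n) x0 < inverse (real (Suc n))" "\<And>n. f differentiable (at (X n))"
    "\<And>n. dist (jacobian f (at (X n))) M < inverse (real (Suc n))" by metis
  have "X \<longlonglongrightarrow> x0" "(\<lambda>n. jacobian f (at (X n))) \<longlonglongrightarrow> M"
    using X(1,3) by (auto intro!: metric_tendsto_imp_tendsto[OF LIMSEQ_inverse_real_of_nat] always_eventually less_imp_le)
  with X(2) show "M \<in> jacobian_limits f x0" by (auto simp: jacobian_limits_def)
qed

lemma compact_jacobian_limits:
  assumes lip: "L-lipschitz_on UNIV f"
  shows "compact (jacobian_limits f x0)"
  unfolding compact_eq_bounded_closed
proof
  show "closed (jacobian_limits f x0)"
    unfolding jacobian_limits_eq_INT_closure by (intro closed_INT) auto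
  show "bounded (jacobian_limits f x0)"
    unfolding bounded_iff
  proof (intro exI ballI)
    fix M assume "M \<in> jacobian_limits f x0"
    then obtain X where X: "\<And>i. f differentiable (at (X i))"
      "(\<lambda>i. jacobian f (at (X i))) \<longlonglongrightarrow> M" by (auto simp: jacobian_limits_def)
    show "norm M \<le> real CARD('a) * (real CARD('a) * L)"
      by (rule tendsto_upperbound[OF tendsto_norm[OF X(2)]])
        (auto intro!: always_eventually norm_matrix_le norm_jacobian_mult_le[OF lip X(1)])
  qed
qed

text \<open>A short increment of \<open>u \<bullet> g\<close> along \<open>v\<close> nearly realizes
  the Jacobian of \<open>g\<close>, and passing to \<open>f\<close> costs at most
  \<open>\<epsilon> * norm u * norm v\<close> per unit step. The mean value inequality then finds a
  nearby point where \<open>f\<close> is differentiable, and compactness provides a limit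
  matrix.\<close>

lemma jacobian_limits_perturb:
  assumes f: "L-lipschitz_on UNIV f" and fg: "\<epsilon>-lipschitz_on UNIV (\<lambda>x. f x - g x)"
    and M: "M \<in> jacobian_limits g x0"
  obtains A where "A \<in> jacobian_limits f x0" "u \<bullet> (M *v v) - \<epsilon> * norm u * norm v \<le> u \<bullet> (A *v v)"
proof -
  obtain X where X: "X \<longlonglongrightarrow> x0" "\<And>i. g differentiable (at (X i))"
    "(\<lambda>i. jacobian g (at (X i))) \<longlonglongrightarrow> M" using M by (auto simp: jacobian_limits_def)
  define \<tau> where "\<tau> i = inverse (real (Suc i))" for i
  have \<tau>: "0 < \<tau> i" for i by (simp add: \<tau>_def)
  have \<tau>0: "\<tau> \<longlonglongrightarrow> 0" unfolding \<tau>_def by (rule LIMSEQ_inverse_real_of_nat)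
  \<comment> \<open>The slack \<open>\<tau> i\<close> makes the inequality strict, as the mean value
    inequality demands, and vanishes in the limit.\<close>
  define c where "c i = u \<bullet> (jacobian g (at (X i)) *v v) - \<tau> i - \<epsilon> * norm u * norm v" for i
  have "\<exists>y. dist y (X i) < 2 * \<tau> i \<and> f differentiable (at y) \<and> c i < u \<bullet> (jacobian f (at y) *v v)" for i
  proof -
    have "\<forall>\<^sub>F t in at 0. u \<bullet> (jacobian g (at (X i)) *v v) - \<tau> i < (u \<bullet> g (X i + t *\<^sub>R v) - u \<bullet> g (X i)) / t"
      by (rule order_tendstoD(1)[OF tendsto_inner_quotient[OF X(2)]]) (use \<tau> in simp)
    then obtain d where d: "0 < d" "\<And>t. t \<noteq> 0 \<Longrightarrow> \<bar>t\<bar> < d \<Longrightarrow>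
        u \<bullet> (jacobian g (at (X i)) *v v) - \<tau> i < (u \<bullet> g (X i + t *\<^sub>R v) - u \<bullet> g (X i)) / t"
      unfolding eventually_at by auto
    \<comment> \<open>The second bound keeps the segment within \<open>\<tau> i\<close> of
      \<open>X i\<close>; \<open>1 + norm v\<close> avoids a zero denominator when
      \<open>v = 0\<close>.\<close>
    define t where "t = min (d / 2) (\<tau> i / (1 + norm v))"
    have t: "0 < t" "t < d" "t * norm v \<le> \<tau> i"
    proof -
      show "0 < t" "t < d" using d \<tau>[of i] by (auto simp: t_def min_less_iff_disj add_pos_nonneg)
      have "t * norm v \<le> \<tau> i / (1 + norm v) * (1 + norm v)"
        using \<open>0 < t\<close> \<tau>[of i] by (intro mult_mono) (auto simp: t_def)
      then show "t * norm v \<le> \<tau> i" by (simp add: add_nonneg_eq_0_iff split: if_splits)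
    qed
    have "(u \<bullet> (jacobian g (at (X i)) *v v) - \<tau> i) * t < u \<bullet> g (X i + t *\<^sub>R v) - u \<bullet> g (X i)"
      using d(2)[of t] t by (simp add: pos_less_divide_eq)
    moreover have "\<bar>u \<bullet> (f (X i + t *\<^sub>R v) - g (X i + t *\<^sub>R v)) - u \<bullet> (f (X i) - g (X i))\<bar> \<le> \<epsilon> * norm u * norm v * t"
      using lipschitz_onD[OF lipschitz_on_inner[OF fg, of u], of "X i + t *\<^sub>R v" "X i"] t
      by (simp add: dist_norm mult_ac)
    ultimately have "c i * t < u \<bullet> f (X i + t *\<^sub>R v) - u \<bullet> f (X i)"
      unfolding c_def by (simp add: inner_diff_right algebra_simps abs_le_iff)
    then obtain s y where sy: "0 < s" "s < t" "dist y (X i + s *\<^sub>R v) < \<tau> i" "f differentiable (at y)"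
        "c i < dir_deriv (\<lambda>z. u \<bullet> f z) v y"
      using lipschitz_mvt_AE[OF lipschitz_on_inner[OF f] rademacher[OF f] t(1) _ \<tau>] by metis
    have "dist (X i + s *\<^sub>R v) (X i) \<le> t * norm v"
      using sy by (simp add: dist_norm mult_right_mono)
    then have "dist y (X i) < 2 * \<tau> i"
      using sy(3) t(3) dist_triangle[of y "X i" "X i + s *\<^sub>R v"] by linarith
    with sy show ?thesis by (auto simp: dir_deriv_inner)
  qed
  then obtain Y where Y: "\<And>i. dist (Y i) (X i) < 2 * \<tau> i" "\<And>i. f differentiable (at (Y i))"
    "\<And>i. c i < u \<bullet> (jacobian f (at (Y i)) *v v)" by metis
  have "Y \<longlonglongrightarrow> x0"
  proof -
    have "(\<lambda>i. dist (Y i) (X i)) \<longlonglongrightarrow> 0"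
      by (rule tendsto_sandwich[OF _ _ tendsto_const tendsto_mult_right_zero[OF \<tau>0, of 2]])
        (use Y(1) in \<open>auto intro!: always_eventually less_imp_le\<close>)
    then have lim0: "(\<lambda>i. dist (Y i) (X i) + dist (X i) x0) \<longlonglongrightarrow> 0"
      using X(1)[THEN tendsto_dist_iff[THEN iffD1]] by (rule tendsto_add_zero)
    have "(\<lambda>i. dist (Y i) x0) \<longlonglongrightarrow> 0"
      by (rule tendsto_sandwich[OF _ _ tendsto_const lim0])
        (auto intro!: always_eventually dist_triangle)
    then show ?thesis by (rule tendsto_dist_iff[THEN iffD2])
  qed
  have bdd: "\<forall>i. jacobian f (at (Y i)) \<in> cball 0 (real CARD('a) * (real CARD('a) * L))"
    by (auto intro!: norm_matrix_le norm_jacobian_mult_le[OF f Y(2)])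
  \<comment> \<open>The Jacobians at \<open>Y i\<close> lie in a fixed compact ball, so a
    subsequence converges.\<close>
  obtain A r where A: "strict_mono r" "((\<lambda>i. jacobian f (at (Y i))) \<circ> r) \<longlonglongrightarrow> A"
    by (rule seq_compactE[OF compact_imp_seq_compact[OF compact_cball] bdd])
  have lin: "(\<lambda>i. u \<bullet> (N i *v v)) \<longlonglongrightarrow> u \<bullet> (B *v v)" if "N \<longlonglongrightarrow> B" for N :: "nat \<Rightarrow> real^'a^'a" and B
    using that unfolding matrix_vector_mult_def by (intro tendsto_intros)
  show thesis
  proof
    show "A \<in> jacobian_limits f x0"
      unfolding jacobian_limits_def
      using A Y(2) LIMSEQ_subseq_LIMSEQ[OF \<open>Y \<longlonglongrightarrow> x0\<close> A(1)]
      by (intro CollectI exI[of _ "Y \<circ> r"]) (auto simp: comp_def)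
    have "c \<longlonglongrightarrow> u \<bullet> (M *v v) - 0 - \<epsilon> * norm u * norm v"
      unfolding c_def by (intro tendsto_intros lin X(3) \<tau>0)
    then have "(c \<circ> r) \<longlonglongrightarrow> u \<bullet> (M *v v) - 0 - \<epsilon> * norm u * norm v"
      using A(1) by (rule LIMSEQ_subseq_LIMSEQ)
    moreover have "(\<lambda>i. u \<bullet> (jacobian f (at (Y (r i))) *v v)) \<longlonglongrightarrow> u \<bullet> (A *v v)"
      using A(2) by (intro lin) (simp add: comp_def)
    ultimately have "u \<bullet> (M *v v) - 0 - \<epsilon> * norm u * norm v \<le> u \<bullet> (A *v v)"
      by (rule LIMSEQ_le) (use Y(3) in \<open>auto intro!: exI[of _ 0] less_imp_le\<close>)
    then show "u \<bullet> (M *v v) - \<epsilon> * norm u * norm v \<le> u \<bullet> (A *v v)" by simp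
  qed
qed

lemma generalized_jacobian_perturb:
  assumes f: "L-lipschitz_on UNIV f" and fg: "\<epsilon>-lipschitz_on UNIV (\<lambda>x. f x - g x)"
    and M: "M \<in> generalized_jacobian g x0"
  obtains A where "A \<in> generalized_jacobian f x0" "u \<bullet> (M *v v) - \<epsilon> * norm u * norm v \<le> u \<bullet> (A *v v)"
proof -
  define \<phi> where "\<phi> N = u \<bullet> (N *v v)" for N :: "real^'a^'a"
  have "linear \<phi>"
    by (rule linearI) (simp_all add: \<phi>_def matrix_vector_mult_add_rdistrib inner_add_right
        flip: scaleR_matrix_vector_assoc)
  \<comment> \<open>If all generators lay in the open half-space where \<open>\<phi>\<close> is
    below \<open>\<phi> M\<close>, so would their convex hull, and with it \<open>M\<close>.\<close>
  have "\<exists>M'\<in>jacobian_limits g x0. \<phi> M \<le> \<phi> M'"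
  proof (rule ccontr)
    assume "\<not> ?thesis"
    then have "jacobian_limits g x0 \<subseteq> \<phi> -` {..<\<phi> M}" by auto
    then have "convex hull jacobian_limits g x0 \<subseteq> \<phi> -` {..<\<phi> M}"
      using \<open>linear \<phi>\<close> by (intro hull_minimal convex_linear_vimage) auto
    with M show False by (auto simp: generalized_jacobian_eq)
  qed
  then obtain M' where M': "M' \<in> jacobian_limits g x0" "u \<bullet> (M *v v) \<le> u \<bullet> (M' *v v)"
    by (auto simp: \<phi>_def)
  obtain A where "A \<in> jacobian_limits f x0" "u \<bullet> (M' *v v) - \<epsilon> * norm u * norm v \<le> u \<bullet> (A *v v)"
    by (rule jacobian_limits_perturb[OF f fg M'(1)])
  with M' show thesis
    by (intro that[of A]) (auto simp: generalized_jacobian_eq hull_inc)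
qed

section \<open>Uniform invertibility and openness\<close>

lemma uniform_lower_bound_if_invertible:
  fixes S :: "(real^'n^'n) set"
  assumes "compact S" and inv: "\<And>A. A \<in> S \<Longrightarrow> invertible A"
  obtains \<delta> where "0 < \<delta>" "\<And>A v. A \<in> S \<Longrightarrow> \<delta> * norm v \<le> norm (A *v v)"
proof (cases "S = {}")
  case True
  then show thesis using that[of 1] by simp
next
  case False
  let ?F = "\<lambda>(A, v). norm (A *v v) :: real"
  \<comment> \<open>\<open>norm (A *v v)\<close> attains its minimum over \<open>S\<close> and the
    unit sphere; invertibility makes it positive, and homogeneity extends the bound to all
    \<open>v\<close>.\<close>
  have "compact (S \<times> sphere (0::real^'n) 1)" using assms(1) by (intro compact_Times compact_sphere)
  moreover have "S \<times> sphere (0::real^'n) 1 \<noteq> {}"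
    using False by auto
  moreover have "continuous_on (S \<times> sphere 0 1) ?F"
    unfolding case_prod_beta matrix_vector_mult_def by (intro continuous_intros)
  ultimately obtain p where p: "p \<in> S \<times> sphere 0 1" "\<And>q. q \<in> S \<times> sphere 0 1 \<Longrightarrow> ?F p \<le> ?F q"
    using continuous_attains_inf by metis
  define \<delta> where "\<delta> = ?F p"
  obtain A w where Aw: "p = (A, w)" "A \<in> S" "norm w = 1" using p(1) by auto
  have "A *v w \<noteq> 0"
    using inv[OF Aw(2)] Aw(3) by (metis invertible_def matrix_left_invertible_ker norm_zero zero_neq_one)
  then have \<delta>: "0 < \<delta>" by (simp add: \<delta>_def Aw)
  have "\<delta> * norm v \<le> norm (B *v v)" if "B \<in> S" for B v
  proof (cases "v = 0")
    case False
    have "\<delta> \<le> norm (B *v (v /\<^sub>R norm v))"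
      using p(2)[of "(B, v /\<^sub>R norm v)"] that False by (simp add: \<delta>_def)
    then show ?thesis using False by (simp add: matrix_vector_mult_scaleR field_simps)
  qed simp
  with \<delta> show thesis by (rule that)
qed

lemma lip_const_imp_lipschitz_on:
  assumes "lip_const f < \<infinity>"
  shows "(real_of_ereal (lip_const f))-lipschitz_on UNIV f"
proof (rule lipschitz_onI)
  show "dist (f x) (f y) \<le> real_of_ereal (lip_const f) * dist x y" for x y
    unfolding dist_norm by (rule lip_const_bound[OF assms])
  show "0 \<le> real_of_ereal (lip_const f)"
    by (rule real_of_ereal_pos[OF lip_const_nonneg])
qed

theorem corollary3p10:
  fixes x0 :: "real^'n"
  shows "openin (Lip_topology x0) {f \<in> Lip x0. of_maximal_rank (generalized_jacobian f x0)}"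
proof -
  interpret Metric_space "Lip x0" lip_dist by (rule Metric_space_Lip)
  show ?thesis
    unfolding openin_mtopology
  proof (intro conjI allI impI)
    fix f assume "f \<in> {f \<in> Lip x0. of_maximal_rank (generalized_jacobian f x0)}"
    then have f: "f \<in> Lip x0" "\<And>A. A \<in> generalized_jacobian f x0 \<Longrightarrow> invertible A"
      by (auto simp: of_maximal_rank_iff_invertible)
    have fin: "lip_const f < \<infinity>" using f(1) unfolding Lip_def by blast
    note lip = lip_const_imp_lipschitz_on[OF fin]
    have comp: "compact (generalized_jacobian f x0)"
      unfolding generalized_jacobian_eq by (intro compact_convex_hull compact_jacobian_limits[OF lip])
    obtain \<delta> where \<delta>: "0 < \<delta>" "\<And>A v. A \<in> generalized_jacobian f x0 \<Longrightarrow> \<delta> * norm v \<le> norm (A *v v)"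
      using uniform_lower_bound_if_invertible[OF comp f(2)] by blast
    \<comment> \<open>The uniform lower bound \<open>\<delta>\<close> itself serves as the radius of
      the ball around \<open>f\<close>.\<close>
    have "of_maximal_rank (generalized_jacobian g x0)" if g: "g \<in> mball f \<delta>" for g
      unfolding of_maximal_rank_iff_invertible
    proof (rule ballI, rule ccontr)
      fix M assume M: "M \<in> generalized_jacobian g x0" "\<not> invertible M"
      then obtain v where v: "M *v v = 0" "v \<noteq> 0"
        by (metis invertible_left_inverse matrix_left_invertible_ker)
      define \<epsilon> where "\<epsilon> = lip_dist f g"
      have \<epsilon>: "\<epsilon> < \<delta>" using g by (simp add: \<epsilon>_def)
      have "g \<in> Lip x0" using g by simp
      then have "lip_const g < \<infinity>" unfolding Lip_def by blast
      then have fg: "\<epsilon>-lipschitz_on UNIV (\<lambda>x. f x - g x)"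
        unfolding \<epsilon>_def lip_dist_def by (intro lip_const_imp_lipschitz_on lip_const_diff_finite fin)
      define K where "K = (\<lambda>A. A *v v) ` generalized_jacobian f x0"
      have lin: "linear (\<lambda>A. A *v v)"
        by (rule linearI) (simp_all add: matrix_vector_mult_add_rdistrib flip: scaleR_matrix_vector_assoc)
      have K: "convex K" "closed K"
        unfolding K_def using lin comp
        by (auto intro!: convex_linear_image compact_imp_closed compact_continuous_image linear_continuous_on
            simp: generalized_jacobian_eq linear_conv_bounded_linear)
      \<comment> \<open>Since \<open>M *v v = 0\<close>, the term with \<open>M\<close> drops out
        and only the perturbation error remains.\<close>
      have sep: "\<exists>k\<in>K. - (\<epsilon> * norm u * norm v) \<le> u \<bullet> k" for u
        using generalized_jacobian_perturb[OF lip fg M(1), of u v] v by (auto simp: K_def)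
      define z where "z = closest_point K 0"
      have "K \<noteq> {}" using sep[of 0] by auto
      then have "z \<in> K" unfolding z_def using K by (intro closest_point_in_set)
      then have z: "\<delta> * norm v \<le> norm z" using \<delta> by (auto simp: K_def)
      obtain k where k: "k \<in> K" "z \<bullet> k \<le> \<epsilon> * norm z * norm v" using sep[of "- z"] by auto
      \<comment> \<open>The variational inequality for the projection of 0 gives
        \<open>z \<bullet> z \<le> z \<bullet> k\<close>; with the bound on
        \<open>z \<bullet> k\<close> this yields \<open>norm z \<le> \<epsilon> * norm v\<close>,
        against \<open>\<delta> * norm v \<le> norm z\<close>.\<close>
      have "(0 - z) \<bullet> (k - z) \<le> 0"
        unfolding z_def using K k(1) by (intro closest_point_dot)
      then have "norm z * norm z \<le> norm z * (\<epsilon> * norm v)"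
        using k(2) by (simp add: inner_diff_right dot_square_norm power2_eq_square mult_ac)
      moreover have "0 < norm z" using z \<delta> v by (meson less_le_trans mult_pos_pos zero_less_norm_iff)
      ultimately have "norm z \<le> \<epsilon> * norm v" by simp
      with z have "\<delta> * norm v \<le> \<epsilon> * norm v" by simp
      with \<epsilon> v show False by simp
    qed
    then show "\<exists>r>0. mball f r \<subseteq> {f \<in> Lip x0. of_maximal_rank (generalized_jacobian f x0)}"
      using \<delta>(1) by (intro exI[of _ \<delta>]) auto
  qed auto
qed

end
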